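(* Let $\beta\in(1,3/2)$. Then $K_\beta$ has an invariant probability measure of the form $m_1\otimes m_2\otimes\mu_\beta$, where $\mu_\beta$ is a probability measure on $S_\beta$ absolutely continuous with respect to the normalized Lebesgue measure $\lambda_2$ on $S_\beta$.
   Context: $\vec q_0=(0,0)$, $\vec q_1=(1,0)$, $\vec q_2=(0,1)$; $S_\beta$ is the attractor of the IFS $f_{\vec q_i}(\vec z)=(\vec z+\vec q_i)/\beta$, here the closed triangle with vertices $(0,0)$, $(\frac1{\beta-1},0)$, $(0,\frac1{\beta-1})$. Subsets of $S_\beta$: $E_0=[0,\frac1\beta)\times[0,\frac1\beta)$; $E_1=\{0\le y<\frac1\beta,\ \frac{1}{\beta(\beta-1)}<x+y\le\frac{1}{\beta-1}\}$; $E_2=\{0\le x<\frac1\beta,\ \frac{1}{\beta(\beta-1)}<x+y\le\frac{1}{\beta-1}\}$; $C_{01}=\{x\ge\frac1\beta,\ 0\le y<\frac1\beta,\ x+y\le\frac{1}{\beta(\beta-1)}\}$; $C_{12}=\{x\ge\frac1\beta,\ y\ge\frac1\beta,\ \frac{1}{\beta(\beta-1)}<x+y\le\frac{1}{\beta-1}\}$; $C_{02}=\{0\le x<\frac1\beta,\ y\ge\frac1\beta,\ x+y\le\frac{1}{\beta(\beta-1)}\}$; $C_{012}=\{x\ge\frac1\beta,\ y\ge\frac1\beta,\ x+y\le\frac{1}{\beta(\beta-1)}\}$. $\Omega=\{0,1\}^{\mathbb N}$, $\Upsilon=\{0,1,2\}^{\mathbb N}$ with product $\sigma$-algebras and left shifts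 $\sigma,\sigma'$. Fix $p\in(0,1)$, $s,t>0$, $s+t<1$; $m_1$ is the product measure on $\Omega$ with weights $p,1-p$ on symbols $0,1$; $m_2$ is the product measure on $\Upsilon$ with weights $s,t,1-s-t$ on symbols $0,1,2$. $K_\beta$ on $\Omega\times\Upsilon\times S_\beta$: $K_\beta(\omega,\upsilon,\vec z)=(\omega,\upsilon,\beta\vec z-\vec q_i)$ if $\vec z\in E_i$; $(\sigma\omega,\upsilon,\beta\vec z-\vec q_i)$ if $\omega_1=0$, $\vec z\in C_{ij}$ ($ij\in\{01,12,02\}$); $(\sigma\omega,\upsilon,\beta\vec z-\vec q_j)$ if $\omega_1=1$, $\vec z\in C_{ij}$; $(\omega,\sigma'\upsilon,\beta\vec z-\vec q_i)$ if $\vec z\in C_{012}$, $\upsilon_1=i$. *)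

theory Defs
  imports "HOL-Probability.Probability"
begin

definition qv :: "nat \<Rightarrow> real \<times> real" where
  "qv i = (if i = 1 then (1, 0) else if i = 2 then (0, 1) else (0, 0))"

definition Sb :: "real \<Rightarrow> (real \<times> real) set" where
  "Sb \<beta> = {(x, y). 0 \<le> x \<and> 0 \<le> y \<and> x + y \<le> 1 / (\<beta> - 1)}"

definition E0 :: "real \<Rightarrow> (real \<times> real) set" where
  "E0 \<beta> = {(x, y). 0 \<le> x \<and> x < 1/\<beta> \<and> 0 \<le> y \<and> y < 1/\<beta>} \<inter> Sb \<beta>"
definition E1 :: "real \<Rightarrow> (real \<times> real) set" where
  "E1 \<beta> = {(x, y). 0 \<le> y \<and> y < 1/\<beta> \<and> 1/(\<beta>*(\<beta>-1)) < x + y \<and> x + y \<le> 1/(\<beta>-1)} \<inter> Sb \<beta>"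
definition E2 :: "real \<Rightarrow> (real \<times> real) set" where
  "E2 \<beta> = {(x, y). 0 \<le> x \<and> x < 1/\<beta> \<and> 1/(\<beta>*(\<beta>-1)) < x + y \<and> x + y \<le> 1/(\<beta>-1)} \<inter> Sb \<beta>"
definition C01 :: "real \<Rightarrow> (real \<times> real) set" where
  "C01 \<beta> = {(x, y). x \<ge> 1/\<beta> \<and> 0 \<le> y \<and> y < 1/\<beta> \<and> x + y \<le> 1/(\<beta>*(\<beta>-1))} \<inter> Sb \<beta>"
definition C12 :: "real \<Rightarrow> (real \<times> real) set" where
  "C12 \<beta> = {(x, y). x \<ge> 1/\<beta> \<and> y \<ge> 1/\<beta> \<and> 1/(\<beta>*(\<beta>-1)) < x + y \<and> x + y \<le> 1/(\<beta>-1)} \<inter> Sb \<beta>"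
definition C02 :: "real \<Rightarrow> (real \<times> real) set" where
  "C02 \<beta> = {(x, y). 0 \<le> x \<and> x < 1/\<beta> \<and> y \<ge> 1/\<beta> \<and> x + y \<le> 1/(\<beta>*(\<beta>-1))} \<inter> Sb \<beta>"
definition C012 :: "real \<Rightarrow> (real \<times> real) set" where
  "C012 \<beta> = {(x, y). x \<ge> 1/\<beta> \<and> y \<ge> 1/\<beta> \<and> x + y \<le> 1/(\<beta>*(\<beta>-1))} \<inter> Sb \<beta>"

definition Tmap :: "real \<Rightarrow> nat \<Rightarrow> real \<times> real \<Rightarrow> real \<times> real" where
  "Tmap \<beta> i z = \<beta> *\<^sub>R z - qv i"

text \<open>Left shift; sequences are indexed from 0, so \<omega> 0 is the paper's \<omega>_1.
  In \<Omega>, False encodes symbol 0 and True encodes symbol 1.\<close>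
definition shift :: "(nat \<Rightarrow> 'a) \<Rightarrow> nat \<Rightarrow> 'a" where
  "shift w = (\<lambda>n. w (Suc n))"

definition Kb :: "real \<Rightarrow> (nat \<Rightarrow> bool) \<times> (nat \<Rightarrow> nat) \<times> (real \<times> real)
                      \<Rightarrow> (nat \<Rightarrow> bool) \<times> (nat \<Rightarrow> nat) \<times> (real \<times> real)" where
  "Kb \<beta> = (\<lambda>(w, v, z).
     if z \<in> E0 \<beta> then (w, v, Tmap \<beta> 0 z)
     else if z \<in> E1 \<beta> then (w, v, Tmap \<beta> 1 z)
     else if z \<in> E2 \<beta> then (w, v, Tmap \<beta> 2 z)
     else if z \<in> C01 \<beta> then (shift w, v, Tmap \<beta> (if w 0 then 1 else 0) z)
     else if z \<in> C12 \<beta> then (shift w, v, Tmap \<beta> (if w 0 then 2 else 1) z)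
     else if z \<in> C02 \<beta> then (shift w, v, Tmap \<beta> (if w 0 then 2 else 0) z)
     else if z \<in> C012 \<beta> then (w, shift v, Tmap \<beta> (v 0) z)
     else (w, v, z))"

definition m1 :: "real \<Rightarrow> (nat \<Rightarrow> bool) measure" where
  "m1 p = PiM UNIV (\<lambda>_. measure_pmf (bernoulli_pmf (1 - p)))"

definition pmf3 :: "real \<Rightarrow> real \<Rightarrow> nat pmf" where
  "pmf3 s t = embed_pmf (\<lambda>n. if n = 0 then s else if n = 1 then t
                              else if n = 2 then 1 - s - t else 0)"

definition m2 :: "real \<Rightarrow> real \<Rightarrow> (nat \<Rightarrow> nat) measure" where
  "m2 s t = PiM UNIV (\<lambda>_. measure_pmf (pmf3 s t))"

definition lambda2 :: "real \<Rightarrow> (real \<times> real) measure" where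
  "lambda2 \<beta> = restrict_space (uniform_measure lborel (Sb \<beta>)) (Sb \<beta>)"

definition invariant_measure :: "'a measure \<Rightarrow> ('a \<Rightarrow> 'a) \<Rightarrow> bool" where
  "invariant_measure M T \<longleftrightarrow> T \<in> measurable M M \<and> distr M M T = M"

end

theory Submission
  imports Defs "HOL-Complex_Analysis.Great_Picard"
begin

text \<open>
  At a point \<open>z\<close> the random map applies the branch \<open>\<beta> z - q\<^sub>i\<close> with a probability \<open>w\<^sub>i z\<close>, and the
  \<open>w\<^sub>i\<close> are constant on the cells cut out by the three lines \<open>x = 1/\<beta>\<close>, \<open>y = 1/\<beta>\<close> and
  \<open>x + y = 1/(\<beta>(\<beta>-1))\<close>. The measure sought is \<open>h\<close> times Lebesgue measure for a fixed density \<open>h\<close>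
  of the transfer operator \<open>P f (z) = \<beta>\<^sup>-\<^sup>2 (\<Sum>i. (w\<^sub>i f) ((z + q\<^sub>i)/\<beta>))\<close>.

  Variation along a coordinate axis \<open>e\<close> is measured by \<open>V\<^sub>h f = \<integral> \<bar>f (z + h e) - f z\<bar> dz\<close>. One
  application of \<open>P\<close> turns \<open>V\<^sub>h\<close> into \<open>V\<^bsub>h/\<beta>\<^esub>\<close>, at the cost of the mass of \<open>f\<close> near the lines
  transversal to \<open>e\<close>. All branches have the same linear part, so lines pull back to parallel lines,
  and the mass near any finite family of parallel lines costs only two variations, whatever the
  family. Hence \<open>V\<^sub>h (P\<^sup>n f) \<le> (1 + 12 n) V\<^bsub>h/\<beta>\<^sup>n\<^esub> f + C\<^sub>n h \<parallel>f\<parallel>\<close>: the loss is linear in \<open>n\<close> while the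
  gain is \<open>\<beta>\<^sup>n\<close>. So the variation of \<open>P\<^sup>n f\<close> stays bounded, the Cesaro means are relatively compact
  in \<open>L\<^sup>1\<close>, and a limit point of them is the fixed density.
\<close>

section \<open>Variation under translations\<close>

text \<open>The product form is what \<open>Kb\<close> preserves by itself: a symbol is discarded
  exactly when it has been used, so after one step from a fixed \<open>z\<close> the remaining
  sequences are again distributed as \<open>m1\<close> and \<open>m2\<close>, independently of the
  branch taken. Integrating them out leaves the weights \<open>w i\<close>, and invariance becomes a
  fixed point equation for a density in the plane. The obstacle is that \<beta> may be arbitrarily
  close to 1. Estimating the strips afresh after each step would cost a factor 13 per step, which
  the gain \<beta> cannot repay. The axes serve as directions because a line parallel to the
  translation is never crossed, so each axis meets only two of the three kinds of lines. The bound
  3/2 enters as \<open>2 \<le> 1/(\<beta>-1)\<close>: the corner (1/\<beta>, 1/\<beta>) of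
  \<open>E0\<close> then lies below the line \<open>x + y = 1/(\<beta>*(\<beta>-1))\<close>, so
  branch 0 keeps \<open>E0\<close> inside the triangle, and the triangle has room for the unit
  square, which carries the starting density.\<close>

lemma nn_integral_lborel_translate:
  fixes f :: "'a::euclidean_space \<Rightarrow> ennreal"
  assumes [measurable]: "f \<in> borel_measurable borel"
  shows "(\<integral>\<^sup>+z. f (z + u) \<partial>lborel) = (\<integral>\<^sup>+z. f z \<partial>lborel)"
proof -
  have "(\<integral>\<^sup>+z. f z \<partial>lborel) = (\<integral>\<^sup>+z. f z \<partial>distr lborel borel ((+) u))"
    by (simp only: lborel_distr_plus)
  also have "\<dots> = (\<integral>\<^sup>+z. f (z + u) \<partial>lborel)"
    by (subst nn_integral_distr) (auto simp: add.commute)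
  finally show ?thesis ..
qed

lemma nn_integral_lborel_scale:
  fixes f :: "'a::euclidean_space \<Rightarrow> ennreal"
  assumes [measurable]: "f \<in> borel_measurable borel" and b: "b > 0"
  shows "(\<integral>\<^sup>+z. f ((1/b) *\<^sub>R (z + q)) \<partial>lborel) = ennreal (b ^ DIM('a)) * (\<integral>\<^sup>+z. f z \<partial>lborel)"
proof -
  have "(\<integral>\<^sup>+z. f ((1/b) *\<^sub>R (z + q)) \<partial>lborel)
     = (\<integral>\<^sup>+z. f ((1/b) *\<^sub>R (z + q)) \<partial>density (distr lborel borel (\<lambda>x. - q + b *\<^sub>R x)) (\<lambda>_. \<bar>b\<bar>^DIM('a)))"
    using lborel_affine[of b "- q"] b by simp
  also have "\<dots> = (\<integral>\<^sup>+z. ennreal (b ^ DIM('a)) * f z \<partial>lborel)"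
    using b by (subst nn_integral_density) (auto simp: nn_integral_distr)
  finally show ?thesis
    by (simp add: nn_integral_cmult)
qed

text \<open>The L1 modulus of continuity. A bound \<open>M * h\<close> for
  \<open>u = h *\<^sub>R e\<close> at all scales \<open>h > 0\<close> plays the part of bounded
  variation along \<open>e\<close>, without derivatives; values in \<open>ennreal\<close> spare
  integrability side conditions.\<close>

definition shift_var :: "'a::euclidean_space \<Rightarrow> ('a \<Rightarrow> real) \<Rightarrow> ennreal" where
  "shift_var u f = (\<integral>\<^sup>+z. ennreal \<bar>f (z + u) - f z\<bar> \<partial>lborel)"

text \<open>If \<open>\<pi>\<close> is linear with \<open>\<pi> e = 1\<close> and \<eta> > 0, these
  are the points whose segment to \<open>z + \<eta> *\<^sub>R e\<close> meets a level
  \<open>\<pi> = c\<close> with \<open>c\<close> in \<open>F\<close>. Both ends are closed, so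
  strict and non-strict switching tests are covered alike.\<close>

definition strip :: "('a \<Rightarrow> real) \<Rightarrow> real set \<Rightarrow> real \<Rightarrow> 'a set" where
  "strip \<pi> F \<eta> = {z. \<exists>c\<in>F. c - \<eta> \<le> \<pi> z \<and> \<pi> z \<le> c}"

lemma strip_measurable [measurable]:
  assumes [measurable]: "\<pi> \<in> borel_measurable M" and "finite F"
  shows "Measurable.pred M (\<lambda>z. z \<in> strip \<pi> F \<eta>)"
  unfolding strip_def mem_Collect_eq using assms(2) by measurable

lemma finite_set_separated:
  fixes F :: "real set"
  assumes "finite F"
  obtains d where "d > 0" "\<And>x y. x \<in> F \<Longrightarrow> y \<in> F \<Longrightarrow> x \<noteq> y \<Longrightarrow> d \<le> \<bar>x - y\<bar>"
proof -
  define G where "G = insert 1 ((\<lambda>(x, y). \<bar>x - y\<bar>) ` {(x, y) \<in> F \<times> F. x \<noteq> y})"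
  have fin: "finite G"
    unfolding G_def using finite_subset[of "{(x, y) \<in> F \<times> F. x \<noteq> y}" "F \<times> F"] assms by auto
  have "Min G > 0"
    using fin by (subst Min_gr_iff) (auto simp: G_def)
  moreover have "Min G \<le> \<bar>x - y\<bar>" if "x \<in> F" "y \<in> F" "x \<noteq> y" for x y
    using fin that by (intro Min_le) (force simp: G_def)+
  ultimately show ?thesis using that by blast
qed

lemma card_le_2_if_close:
  fixes L :: "nat set"
  assumes "finite L" "\<And>k l. k \<in> L \<Longrightarrow> l \<in> L \<Longrightarrow> l \<le> k + 1"
  shows "card L \<le> 2"
proof (cases "L = {}")
  case False
  have "L \<subseteq> {Min L, Min L + 1}"
  proof
    fix l assume "l \<in> L"
    then show "l \<in> {Min L, Min L + 1}"
      using assms(2)[OF Min_in[OF assms(1) False], of l] Min_le[OF assms(1), of l] by auto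
  qed
  then have "card L \<le> card {Min L, Min L + 1}" by (intro card_mono) auto
  then show ?thesis by simp
qed simp

text \<open>Compare the strip with its translates by \<open>k \<eta> e\<close>, for \<open>k\<close> up to about \<open>d / (2 \<eta>)\<close> where \<open>d\<close> is
  the minimal gap of \<open>F\<close>: every point lies in at most two of them. The coefficient of the variation
  does not depend on \<open>F\<close>.\<close>

lemma strip_bound:
  fixes \<pi> :: "'a::euclidean_space \<Rightarrow> real"
  assumes lin: "linear \<pi>" and e: "\<pi> e = 1" and F: "finite F"
  shows "\<exists>C\<ge>0. \<forall>\<eta>>0. \<forall>f. f \<in> borel_measurable borel \<longrightarrow> (\<forall>z. 0 \<le> f z) \<longrightarrow>
    (\<integral>\<^sup>+z. ennreal (f z) * indicator (strip \<pi> F \<eta>) z \<partial>lborel)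
      \<le> 2 * shift_var (\<eta> *\<^sub>R e) f + ennreal (C * \<eta>) * (\<integral>\<^sup>+z. ennreal (f z) \<partial>lborel)"
proof -
  obtain d where d: "d > 0" "\<And>x y. x \<in> F \<Longrightarrow> y \<in> F \<Longrightarrow> x \<noteq> y \<Longrightarrow> d \<le> \<bar>x - y\<bar>"
    using finite_set_separated[OF F] by blast
  have [measurable]: "\<pi> \<in> borel_measurable borel"
    using lin linear_continuous_on[of \<pi> UNIV] by (intro borel_measurable_continuous_onI) (simp add: linear_conv_bounded_linear)
  note [measurable] = F
  have \<pi>: "\<pi> (z + c *\<^sub>R e) = \<pi> z + c" "\<pi> (z - c *\<^sub>R e) = \<pi> z - c" for z c
    using e by (simp_all add: linear_add[OF lin] linear_diff[OF lin] linear_cmul[OF lin])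
  show ?thesis
  \<comment> \<open>Averaging over \<open>K\<close> translates gives the factor 2/K, and
    \<open>K \<ge> d / (4 * \<eta>)\<close> turns it into 8\<eta>/d. For wide strips, \<eta> > d/4,
    the factor exceeds 2 and the total mass alone is enough.\<close>
  proof (intro exI[of _ "8 / d"] conjI allI impI)
    show "0 \<le> 8 / d" using d by simp
    fix \<eta> :: real and f :: "'a \<Rightarrow> real"
    assume \<eta>: "0 < \<eta>" and [measurable]: "f \<in> borel_measurable borel" and pos: "\<forall>z. 0 \<le> f z"
    let ?A = "strip \<pi> F \<eta>" and ?I = "\<integral>\<^sup>+z. ennreal (f z) \<partial>lborel"
    let ?J = "\<integral>\<^sup>+z. ennreal (f z) * indicator ?A z \<partial>lborel"
    show "?J \<le> 2 * shift_var (\<eta> *\<^sub>R e) f + ennreal (8 / d * \<eta>) * ?I"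
    proof (cases "\<eta> \<le> d / 4")
      case False
      have "?J \<le> 1 * ?I" by (simp, intro nn_integral_mono) (auto split: split_indicator)
      also have "\<dots> \<le> ennreal (8 / d * \<eta>) * ?I"
        using False d by (intro mult_right_mono) (auto simp: field_simps)
      finally show ?thesis by (simp add: add_increasing)
    next
      case True
      \<comment> \<open>All translations stay within d/2. With \<eta> \<le> d/4, two levels whose
        translated strips share a point differ by at most 3d/4 < d, hence are equal.\<close>
      define K where "K = nat \<lfloor>d / (2 * \<eta>)\<rfloor>"
      have x2: "d / (2 * \<eta>) \<ge> 2" using True \<eta> by (simp add: field_simps)
      have K1: "real K \<le> d / (2 * \<eta>)" "real K > d / (2 * \<eta>) - 1"
        unfolding K_def using x2 by linarith+
      have K: "real K * \<eta> \<le> d / 2" "d / (4 * \<eta>) \<le> real K" "K > 0"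
      proof -
        show "real K * \<eta> \<le> d / 2" using K1(1) \<eta> by (simp add: field_simps)
        have "d / (4 * \<eta>) = d / (2 * \<eta>) / 2" by simp
        then show "d / (4 * \<eta>) \<le> real K" using K1(2) x2 by linarith
        show "K > 0" using K1(2) x2 by (cases K) auto
      qed
      have count: "(\<Sum>k<K. indicator ?A (z - (k * \<eta>) *\<^sub>R e)) \<le> (2 :: ennreal)" for z
      proof -
        define L where "L = {k. k < K \<and> z - (k * \<eta>) *\<^sub>R e \<in> ?A}"
        have "card L \<le> 2"
        proof (rule card_le_2_if_close)
          show "finite L" unfolding L_def by simp
          fix k l assume kl: "k \<in> L" "l \<in> L"
          then obtain c c' where c: "c \<in> F" "c - \<eta> \<le> \<pi> z - k * \<eta>" "\<pi> z - k * \<eta> \<le> c"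
            and c': "c' \<in> F" "c' - \<eta> \<le> \<pi> z - l * \<eta>" "\<pi> z - l * \<eta> \<le> c'"
            unfolding L_def strip_def by (auto simp: \<pi>)
          have le: "real j * \<eta> \<le> d / 2" if "j \<in> L" for j
          proof -
            have "real j * \<eta> \<le> real K * \<eta>" using that \<eta> by (intro mult_right_mono) (auto simp: L_def)
            then show ?thesis using K(1) by linarith
          qed
          have b: "real k * \<eta> \<le> d / 2" "real l * \<eta> \<le> d / 2" "0 \<le> real k * \<eta>" "0 \<le> real l * \<eta>"
            using kl le \<eta> by simp_all
          have "\<bar>c - c'\<bar> < d"
            using c(2,3) c'(2,3) b True \<eta> d(1) by linarith
          then have "c = c'" using d(2)[OF c(1) c'(1)] by auto
          \<comment> \<open>For one level, closed strips of width \<eta> shifted by multiples of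
            \<eta> meet only if they are neighbours. The shared end points are the reason for
            multiplicity 2 instead of 1.\<close>
          then have "(real l - real k) * \<eta> \<le> 1 * \<eta>" using c c' by (simp add: algebra_simps)
          then have "real l - real k \<le> 1" using \<eta> by (simp only: mult_le_cancel_right_pos)
          then show "l \<le> k + 1" by linarith
        qed
        then have "(of_nat (card L) :: ennreal) \<le> of_nat 2"
          by (simp only: of_nat_le_iff)
        moreover have "(\<Sum>k<K. indicator ?A (z - (k * \<eta>) *\<^sub>R e)) = (\<Sum>k\<in>L. 1 :: ennreal)"
          unfolding L_def by (rule sum.mono_neutral_cong_right) auto
        ultimately show ?thesis by simp
      qed
      have shifts: "(\<Sum>k<K. \<integral>\<^sup>+z. G (z + (k * \<eta>) *\<^sub>R e) * indicator ?A z \<partial>lborel) \<le> 2 * (\<integral>\<^sup>+z. G z \<partial>lborel)"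
        if [measurable]: "G \<in> borel_measurable borel" for G
      proof -
        have "(\<Sum>k<K. \<integral>\<^sup>+z. G (z + (k * \<eta>) *\<^sub>R e) * indicator ?A z \<partial>lborel)
            = (\<Sum>k<K. \<integral>\<^sup>+z. G z * indicator ?A (z - (k * \<eta>) *\<^sub>R e) \<partial>lborel)"
        proof (rule sum.cong)
          fix k
          show "(\<integral>\<^sup>+z. G (z + (k * \<eta>) *\<^sub>R e) * indicator ?A z \<partial>lborel)
            = (\<integral>\<^sup>+z. G z * indicator ?A (z - (k * \<eta>) *\<^sub>R e) \<partial>lborel)"
            by (subst nn_integral_lborel_translate[of "\<lambda>z. G z * indicator ?A (z - (k * \<eta>) *\<^sub>R e)"
                  "(k * \<eta>) *\<^sub>R e", symmetric]) auto
        qed simp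
        also have "\<dots> = (\<integral>\<^sup>+z. G z * (\<Sum>k<K. indicator ?A (z - (k * \<eta>) *\<^sub>R e)) \<partial>lborel)"
          by (subst nn_integral_sum[symmetric]) (auto simp: sum_distrib_left)
        also have "\<dots> \<le> (\<integral>\<^sup>+z. G z * 2 \<partial>lborel)"
          by (intro nn_integral_mono mult_left_mono count) auto
        finally show ?thesis by (simp add: nn_integral_multc mult.commute)
      qed
      define D where "D z = ennreal \<bar>f (z + \<eta> *\<^sub>R e) - f z\<bar>" for z
      have [measurable]: "D \<in> borel_measurable borel" unfolding D_def by measurable
      have tele: "ennreal (f z) \<le> ennreal (f (z + (k * \<eta>) *\<^sub>R e)) + (\<Sum>l<k. D (z + (l * \<eta>) *\<^sub>R e))" for k :: nat and z
      proof -
        have "f z \<le> f (z + (k * \<eta>) *\<^sub>R e) + (\<Sum>l<k. \<bar>f (z + (l * \<eta>) *\<^sub>R e + \<eta> *\<^sub>R e) - f (z + (l * \<eta>) *\<^sub>R e)\<bar>)"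
        proof (induction k)
          case (Suc k)
          have "z + (real k * \<eta>) *\<^sub>R e + \<eta> *\<^sub>R e = z + (real (Suc k) * \<eta>) *\<^sub>R e"
            by (simp add: algebra_simps)
          then show ?case using Suc.IH unfolding sum.lessThan_Suc by (simp only:)
        qed simp
        then have "ennreal (f z) \<le> ennreal (f (z + (k * \<eta>) *\<^sub>R e) + (\<Sum>l<k. \<bar>f (z + (l * \<eta>) *\<^sub>R e + \<eta> *\<^sub>R e) - f (z + (l * \<eta>) *\<^sub>R e)\<bar>))"
          by (rule ennreal_leI)
        then show ?thesis
          using pos by (simp add: D_def sum_nonneg ennreal_plus sum_ennreal)
      qed
      \<comment> \<open>Each of the \<open>K\<close> copies of the strip mass is moved by a
        different number of steps. Increments are summed up to \<open>K\<close> instead of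
        \<open>k\<close>, which bounds every copy by the same two variations; division by
        \<open>K\<close> then leaves the coefficient 2.\<close>
      have "of_nat K * ?J = (\<Sum>k<K. ?J)" by simp
      also have "\<dots> \<le> (\<Sum>k<K. (\<integral>\<^sup>+z. ennreal (f (z + (k * \<eta>) *\<^sub>R e)) * indicator ?A z \<partial>lborel)
          + (\<Sum>l<K. \<integral>\<^sup>+z. D (z + (l * \<eta>) *\<^sub>R e) * indicator ?A z \<partial>lborel))"
      proof (rule sum_mono)
        fix k assume "k \<in> {..<K}"
        then have sub: "{..<k} \<subseteq> {..<K}" by auto
        have "?J \<le> (\<integral>\<^sup>+z. ennreal (f (z + (k * \<eta>) *\<^sub>R e)) * indicator ?A z
            + (\<Sum>l<K. D (z + (l * \<eta>) *\<^sub>R e) * indicator ?A z) \<partial>lborel)"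
        proof (rule nn_integral_mono)
          fix z
          have "ennreal (f z) \<le> ennreal (f (z + (k * \<eta>) *\<^sub>R e)) + (\<Sum>l<K. D (z + (l * \<eta>) *\<^sub>R e))"
            using tele[of z k] sum_mono2[OF _ sub, of "\<lambda>l. D (z + (l * \<eta>) *\<^sub>R e)"]
            by (meson add_left_mono finite_lessThan order_trans zero_le)
          then show "ennreal (f z) * indicator ?A z \<le> ennreal (f (z + (k * \<eta>) *\<^sub>R e)) * indicator ?A z
            + (\<Sum>l<K. D (z + (l * \<eta>) *\<^sub>R e) * indicator ?A z)"
            by (cases "z \<in> ?A") simp_all
        qed
        also have "\<dots> = (\<integral>\<^sup>+z. ennreal (f (z + (k * \<eta>) *\<^sub>R e)) * indicator ?A z \<partial>lborel)
          + (\<integral>\<^sup>+z. (\<Sum>l<K. D (z + (l * \<eta>) *\<^sub>R e) * indicator ?A z) \<partial>lborel)"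
          by (rule nn_integral_add) measurable
        also have "(\<integral>\<^sup>+z. (\<Sum>l<K. D (z + (l * \<eta>) *\<^sub>R e) * indicator ?A z) \<partial>lborel)
          = (\<Sum>l<K. \<integral>\<^sup>+z. D (z + (l * \<eta>) *\<^sub>R e) * indicator ?A z \<partial>lborel)"
          by (rule nn_integral_sum) measurable
        finally show "?J \<le> (\<integral>\<^sup>+z. ennreal (f (z + (k * \<eta>) *\<^sub>R e)) * indicator ?A z \<partial>lborel)
          + (\<Sum>l<K. \<integral>\<^sup>+z. D (z + (l * \<eta>) *\<^sub>R e) * indicator ?A z \<partial>lborel)" .
      qed
      also have "\<dots> = (\<Sum>k<K. \<integral>\<^sup>+z. ennreal (f (z + (k * \<eta>) *\<^sub>R e)) * indicator ?A z \<partial>lborel)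
          + of_nat K * (\<Sum>l<K. \<integral>\<^sup>+z. D (z + (l * \<eta>) *\<^sub>R e) * indicator ?A z \<partial>lborel)"
        by (simp add: sum.distrib)
      also have "\<dots> \<le> 2 * ?I + of_nat K * (2 * (\<integral>\<^sup>+z. D z \<partial>lborel))"
        by (intro add_mono mult_left_mono shifts) auto
      also have "\<dots> = of_nat K * (2 * shift_var (\<eta> *\<^sub>R e) f + ennreal (2 / K) * ?I)"
      proof -
        have "of_nat K * (ennreal (2 / K) * ?I) = 2 * ?I"
          using K(3) by (simp add: mult.assoc[symmetric] ennreal_of_nat_eq_real_of_nat ennreal_mult[symmetric])
        then show ?thesis
          by (simp add: distrib_left shift_var_def D_def add.commute)
      qed
      finally have "?J \<le> 2 * shift_var (\<eta> *\<^sub>R e) f + ennreal (2 / K) * ?I"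
        using K(3) by (subst (asm) ennreal_mult_le_mult_iff) auto
      also have "\<dots> \<le> 2 * shift_var (\<eta> *\<^sub>R e) f + ennreal (8 / d * \<eta>) * ?I"
        using K d \<eta> by (intro add_left_mono mult_right_mono ennreal_leI) (auto simp: field_simps)
      finally show ?thesis .
    qed
  qed
qed

section \<open>The transfer operator\<close>

locale switched_expansion =
  fixes \<beta> :: real and w :: "nat \<Rightarrow> real \<times> real \<Rightarrow> real"
  assumes \<beta>: "1 < \<beta>"
    and w_measurable [measurable]: "\<And>i. w i \<in> borel_measurable borel"
    and w_nonneg: "\<And>i z. 0 \<le> w i z"
    and w_sum: "\<And>z. (\<Sum>i<3. w i z) = 1"
begin

definition transfer :: "(real \<times> real \<Rightarrow> real) \<Rightarrow> real \<times> real \<Rightarrow> real" where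
  "transfer f z = (\<Sum>i<3. w i ((1/\<beta>) *\<^sub>R (z + qv i)) * f ((1/\<beta>) *\<^sub>R (z + qv i))) / \<beta>\<^sup>2"

lemma w_le_1: "i < 3 \<Longrightarrow> w i z \<le> 1"
  using w_sum[of z] member_le_sum[of i "{..<3}" "\<lambda>i. w i z"] w_nonneg by auto

lemma inverse_branch_measurable [measurable]: "(\<lambda>z. (1/\<beta>) *\<^sub>R (z + q)) \<in> borel_measurable (borel :: (real \<times> real) measure)"
  by (intro borel_measurable_continuous_onI continuous_intros)

lemma transfer_measurable [measurable]:
  assumes [measurable]: "f \<in> borel_measurable borel"
  shows "transfer f \<in> borel_measurable borel"
  unfolding transfer_def
  by (intro borel_measurable_divide borel_measurable_sum borel_measurable_times borel_measurable_const
      measurable_compose[OF inverse_branch_measurable] w_measurable assms)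

lemma transfer_nonneg: "(\<And>z. 0 \<le> f z) \<Longrightarrow> 0 \<le> transfer f z"
  unfolding transfer_def by (intro divide_nonneg_nonneg sum_nonneg mult_nonneg_nonneg w_nonneg) auto

lemma Tmap_inverse [simp]: "Tmap \<beta> i ((1/\<beta>) *\<^sub>R (z + qv i)) = z" "(1/\<beta>) *\<^sub>R (Tmap \<beta> i z + qv i) = z"
  using \<beta> by (simp_all add: Tmap_def)

lemma Tmap_measurable [measurable]: "Tmap \<beta> i \<in> borel_measurable borel"
  unfolding Tmap_def by measurable

lemma nn_integral_inverse_branch:
  assumes [measurable]: "f \<in> borel_measurable borel"
  shows "(\<integral>\<^sup>+z. f ((1/\<beta>) *\<^sub>R (z + q)) \<partial>lborel) = ennreal (\<beta>\<^sup>2) * (\<integral>\<^sup>+z. f z \<partial>(lborel :: (real \<times> real) measure))"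
  using nn_integral_lborel_scale[of f \<beta> q] \<beta> by (simp add: power2_eq_square)

text \<open>Change of variables in each branch; its Jacobian cancels the normalisation of
  \<open>transfer\<close>. The test function decides the use: a constant gives conservation of mass,
  the indicator of a strip its pullback, and a fibre integral of \<open>Kb\<close> the
  invariance.\<close>

lemma transfer_adjoint:
  assumes [measurable]: "f \<in> borel_measurable borel" "\<phi> \<in> borel_measurable borel" and pos: "\<And>z. 0 \<le> f z"
  shows "(\<integral>\<^sup>+z. ennreal (transfer f z) * \<phi> z \<partial>lborel)
    = (\<integral>\<^sup>+z. ennreal (f z) * (\<Sum>i<3. ennreal (w i z) * \<phi> (Tmap \<beta> i z)) \<partial>lborel)"
proof -
  define H where "H i z = ennreal (w i z * f z / \<beta>\<^sup>2) * \<phi> (Tmap \<beta> i z)" for i z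
  have [measurable]: "H i \<in> borel_measurable borel" for i unfolding H_def by measurable
  have "(\<integral>\<^sup>+z. ennreal (transfer f z) * \<phi> z \<partial>lborel) = (\<integral>\<^sup>+z. (\<Sum>i<3. H i ((1/\<beta>) *\<^sub>R (z + qv i))) \<partial>lborel)"
  proof (intro nn_integral_cong)
    fix z
    have "ennreal (transfer f z) = (\<Sum>i<3. ennreal (w i ((1/\<beta>) *\<^sub>R (z + qv i)) * f ((1/\<beta>) *\<^sub>R (z + qv i)) / \<beta>\<^sup>2))"
      unfolding transfer_def sum_divide_distrib by (rule sum_ennreal[symmetric]) (simp add: w_nonneg pos)
    then show "ennreal (transfer f z) * \<phi> z = (\<Sum>i<3. H i ((1/\<beta>) *\<^sub>R (z + qv i)))"
      by (simp only: H_def sum_distrib_right Tmap_inverse)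
  qed
  also have "\<dots> = (\<Sum>i<3. ennreal (\<beta>\<^sup>2) * (\<integral>\<^sup>+z. H i z \<partial>lborel))"
    by (subst nn_integral_sum) (auto intro!: sum.cong nn_integral_inverse_branch)
  also have "\<dots> = (\<integral>\<^sup>+z. (\<Sum>i<3. ennreal (\<beta>\<^sup>2) * H i z) \<partial>lborel)"
    by (subst nn_integral_sum) (auto intro!: sum.cong simp: nn_integral_cmult)
  also have "\<dots> = (\<integral>\<^sup>+z. ennreal (f z) * (\<Sum>i<3. ennreal (w i z) * \<phi> (Tmap \<beta> i z)) \<partial>lborel)"
  proof (intro nn_integral_cong)
    fix z
    have "ennreal (\<beta>\<^sup>2) * H i z = ennreal (f z) * (ennreal (w i z) * \<phi> (Tmap \<beta> i z))" for i
      using \<beta> unfolding H_def mult.assoc[symmetric]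
      by (simp add: ennreal_mult[symmetric] w_nonneg pos mult.commute)
    then show "(\<Sum>i<3. ennreal (\<beta>\<^sup>2) * H i z) = ennreal (f z) * (\<Sum>i<3. ennreal (w i z) * \<phi> (Tmap \<beta> i z))"
      by (simp add: sum_distrib_left)
  qed
  finally show ?thesis .
qed

lemma w_sum_ennreal: "(\<Sum>i<3. ennreal (w i z)) = 1"
  by (simp add: sum_ennreal w_nonneg w_sum)

lemma transfer_integral:
  assumes [measurable]: "f \<in> borel_measurable borel" and "\<And>z. 0 \<le> f z"
  shows "(\<integral>\<^sup>+z. ennreal (transfer f z) \<partial>lborel) = (\<integral>\<^sup>+z. ennreal (f z) \<partial>lborel)"
  using transfer_adjoint[of f "\<lambda>_. 1"] assms by (simp add: w_sum_ennreal)

lemma transfer_contraction: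
  assumes [measurable]: "f \<in> borel_measurable borel"
  shows "(\<integral>\<^sup>+z. ennreal \<bar>transfer f z\<bar> \<partial>lborel) \<le> (\<integral>\<^sup>+z. ennreal \<bar>f z\<bar> \<partial>lborel)"
proof -
  have "\<bar>transfer f z\<bar> \<le> transfer (\<lambda>z. \<bar>f z\<bar>) z" for z
    unfolding transfer_def abs_divide
    by (intro divide_mono order_trans[OF sum_abs] sum_mono) (use \<beta> in \<open>auto simp: abs_mult w_nonneg\<close>)
  then have "(\<integral>\<^sup>+z. ennreal \<bar>transfer f z\<bar> \<partial>lborel) \<le> (\<integral>\<^sup>+z. ennreal (transfer (\<lambda>z. \<bar>f z\<bar>) z) \<partial>lborel)"
    by (intro nn_integral_mono ennreal_leI)
  then show ?thesis by (simp add: transfer_integral)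
qed

text \<open>Every branch multiplies by \<beta>, so levels of \<open>\<pi>\<close> pull back to
  levels of \<open>\<pi>\<close> and widths shrink by \<beta>. All three preimages are enlarged to
  the common strip over \<open>F'\<close>; the weights then sum to 1 and no factor 3
  appears.\<close>

lemma transfer_strip:
  assumes lin: "linear \<pi>" and F: "finite F"
    and [measurable]: "f \<in> borel_measurable borel" and pos: "\<And>z. 0 \<le> f z"
  defines "F' \<equiv> (\<Union>i<3. (\<lambda>c. (c + \<pi> (qv i)) / \<beta>) ` F)"
  shows "(\<integral>\<^sup>+z. ennreal (transfer f z) * indicator (strip \<pi> F \<eta>) z \<partial>lborel)
    \<le> (\<integral>\<^sup>+z. ennreal (f z) * indicator (strip \<pi> F' (\<eta> / \<beta>)) z \<partial>lborel)"
proof -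
  have [measurable]: "\<pi> \<in> borel_measurable borel"
    using lin linear_continuous_on[of \<pi> UNIV] by (intro borel_measurable_continuous_onI) (simp add: linear_conv_bounded_linear)
  note [measurable] = F
  have "(\<integral>\<^sup>+z. ennreal (transfer f z) * indicator (strip \<pi> F \<eta>) z \<partial>lborel)
    = (\<integral>\<^sup>+z. ennreal (f z) * (\<Sum>i<3. ennreal (w i z) * indicator (strip \<pi> F \<eta>) (Tmap \<beta> i z)) \<partial>lborel)"
    by (rule transfer_adjoint) (auto simp: pos)
  also have "\<dots> \<le> (\<integral>\<^sup>+z. ennreal (f z) * (\<Sum>i<3. ennreal (w i z) * indicator (strip \<pi> F' (\<eta> / \<beta>)) z) \<partial>lborel)"
  proof (intro nn_integral_mono mult_left_mono sum_mono)
    fix z i assume i: "i \<in> {..<3::nat}"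
    have "z \<in> strip \<pi> F' (\<eta> / \<beta>)" if "Tmap \<beta> i z \<in> strip \<pi> F \<eta>"
    proof -
      from that obtain c where c: "c \<in> F" "c - \<eta> \<le> \<beta> * \<pi> z - \<pi> (qv i)" "\<beta> * \<pi> z - \<pi> (qv i) \<le> c"
        by (auto simp: strip_def Tmap_def linear_diff[OF lin] linear_cmul[OF lin])
      have "(c + \<pi> (qv i)) / \<beta> - \<eta> / \<beta> \<le> \<pi> z" "\<pi> z \<le> (c + \<pi> (qv i)) / \<beta>"
        using c \<beta> by (simp_all add: diff_divide_distrib[symmetric] pos_divide_le_eq pos_le_divide_eq mult.commute)
      moreover have "(c + \<pi> (qv i)) / \<beta> \<in> F'" using i c unfolding F'_def by auto
      ultimately show ?thesis unfolding strip_def by blast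
    qed
    then show "indicator (strip \<pi> F \<eta>) (Tmap \<beta> i z) \<le> (indicator (strip \<pi> F' (\<eta> / \<beta>)) z :: ennreal)"
      by (auto split: split_indicator)
  qed auto
  also have "\<dots> = (\<integral>\<^sup>+z. ennreal (f z) * indicator (strip \<pi> F' (\<eta> / \<beta>)) z \<partial>lborel)"
    by (simp add: sum_distrib_right[symmetric] w_sum_ennreal)
  finally show ?thesis .
qed

lemma funpow_transfer_measurable [measurable]:
  "f \<in> borel_measurable borel \<Longrightarrow> (transfer ^^ n) f \<in> borel_measurable borel"
  by (induction n) auto

lemma funpow_transfer_nonneg: "(\<And>z. 0 \<le> f z) \<Longrightarrow> 0 \<le> (transfer ^^ n) f z"
  by (induction n arbitrary: z) (auto intro: transfer_nonneg)

lemma funpow_transfer_integral: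
  assumes [measurable]: "f \<in> borel_measurable borel" and "\<And>z. 0 \<le> f z"
  shows "(\<integral>\<^sup>+z. ennreal ((transfer ^^ n) f z) \<partial>lborel) = (\<integral>\<^sup>+z. ennreal (f z) \<partial>lborel)"
  by (induction n) (auto simp: transfer_integral assms funpow_transfer_nonneg)

text \<open>The number of levels may grow like \<open>3 ^ n\<close> while their gaps shrink. This is
  harmless: in \<open>strip_bound\<close> only the constant in front of the mass depends on the
  levels, and \<open>F'\<close> is chosen before \<open>\<eta>\<close> and \<open>f\<close>, so that
  constant is uniform in both.\<close>

lemma funpow_transfer_strip:
  assumes lin: "linear \<pi>" and F: "finite F"
  shows "\<exists>F'. finite F' \<and> (\<forall>\<eta> f. f \<in> borel_measurable borel \<longrightarrow> (\<forall>z. 0 \<le> f z) \<longrightarrow>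
    (\<integral>\<^sup>+z. ennreal ((transfer ^^ n) f z) * indicator (strip \<pi> F \<eta>) z \<partial>lborel)
    \<le> (\<integral>\<^sup>+z. ennreal (f z) * indicator (strip \<pi> F' (\<eta> / \<beta> ^ n)) z \<partial>lborel))"
  using F
proof (induction n arbitrary: F)
  case 0
  then show ?case by auto
next
  case (Suc n)
  define G where "G = (\<Union>i<3. (\<lambda>c. (c + \<pi> (qv i)) / \<beta>) ` F)"
  have "finite G" using Suc.prems unfolding G_def by auto
  from Suc.IH[OF this] obtain F' where F': "finite F'" and IH: "\<And>\<eta> f. f \<in> borel_measurable borel \<Longrightarrow> (\<forall>z. 0 \<le> f z) \<Longrightarrow>
    (\<integral>\<^sup>+z. ennreal ((transfer ^^ n) f z) * indicator (strip \<pi> G \<eta>) z \<partial>lborel)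
    \<le> (\<integral>\<^sup>+z. ennreal (f z) * indicator (strip \<pi> F' (\<eta> / \<beta> ^ n)) z \<partial>lborel)" by blast
  show ?case
  proof (intro exI[of _ F'] conjI allI impI F')
    fix \<eta> :: real and f :: "real \<times> real \<Rightarrow> real"
    assume [measurable]: "f \<in> borel_measurable borel" and pos: "\<forall>z. 0 \<le> f z"
    have "(\<integral>\<^sup>+z. ennreal ((transfer ^^ Suc n) f z) * indicator (strip \<pi> F \<eta>) z \<partial>lborel)
      \<le> (\<integral>\<^sup>+z. ennreal ((transfer ^^ n) f z) * indicator (strip \<pi> G (\<eta> / \<beta>)) z \<partial>lborel)"
      unfolding funpow.simps o_apply G_def
      by (rule transfer_strip[OF lin Suc.prems]) (auto simp: pos funpow_transfer_nonneg)
    also have "\<dots> \<le> (\<integral>\<^sup>+z. ennreal (f z) * indicator (strip \<pi> F' (\<eta> / \<beta> ^ Suc n)) z \<partial>lborel)"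
      using IH[of f "\<eta> / \<beta>"] pos by simp
    finally show "(\<integral>\<^sup>+z. ennreal ((transfer ^^ Suc n) f z) * indicator (strip \<pi> F \<eta>) z \<partial>lborel) \<le> \<dots>" .
  qed
qed

end

section \<open>Variation inequality for iterates along one direction\<close>

text \<open>The lines transversal to \<open>e\<close> are levels of \<open>\<pi>1\<close> and
  \<open>\<pi>2\<close>. Normalising both functionals to 1 on \<open>e\<close> makes each strip as
  wide as the translation is long.\<close>

locale two_strip_expansion = switched_expansion +
  fixes e :: "real \<times> real" and \<pi>1 \<pi>2 :: "real \<times> real \<Rightarrow> real" and c1 c2 :: real
  assumes linear: "linear \<pi>1" "linear \<pi>2"
    and unit: "\<pi>1 e = 1" "\<pi>2 e = 1"
    and switch: "\<And>i z \<eta>. i < 3 \<Longrightarrow> 0 < \<eta> \<Longrightarrow> w i (z + \<eta> *\<^sub>R e) \<noteq> w i z \<Longrightarrow>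
      z \<in> strip \<pi>1 {c1} \<eta> \<or> z \<in> strip \<pi>2 {c2} \<eta>"
begin

lemma proj_measurable [measurable]: "\<pi>1 \<in> borel_measurable borel" "\<pi>2 \<in> borel_measurable borel"
  using linear linear_continuous_on[of _ UNIV]
  by (auto intro!: borel_measurable_continuous_onI simp: linear_conv_bounded_linear)

text \<open>Product rule: the increment of \<open>w i * f\<close> is \<open>w i (z + u)\<close>
  times the increment of \<open>f\<close>, plus the increment of \<open>w i\<close> times
  \<open>f z\<close>. The weights sum to 1, so the first part keeps coefficient 1; the second is at
  most \<open>f\<close> on the strips, once for each of the three branches.\<close>

lemma shift_var_transfer:
  assumes [measurable]: "f \<in> borel_measurable borel" and pos: "\<And>z. 0 \<le> f z" and h: "0 < h"
  shows "shift_var (h *\<^sub>R e) (transfer f) \<le> shift_var ((h / \<beta>) *\<^sub>R e) f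
     + (3 * (\<integral>\<^sup>+z. ennreal (f z) * indicator (strip \<pi>1 {c1} (h / \<beta>)) z \<partial>lborel)
      + 3 * (\<integral>\<^sup>+z. ennreal (f z) * indicator (strip \<pi>2 {c2} (h / \<beta>)) z \<partial>lborel))"
proof -
  define u where "u = (h / \<beta>) *\<^sub>R e"
  define G where "G i y = \<bar>w i (y + u) * f (y + u) - w i y * f y\<bar>" for i y
  let ?s1 = "strip \<pi>1 {c1} (h / \<beta>)" and ?s2 = "strip \<pi>2 {c2} (h / \<beta>)"
  have [measurable]: "G i \<in> borel_measurable borel" for i unfolding G_def by measurable
  have "shift_var (h *\<^sub>R e) (transfer f)
     \<le> (\<integral>\<^sup>+z. (\<Sum>i<3. ennreal (G i ((1/\<beta>) *\<^sub>R (z + qv i)) / \<beta>\<^sup>2)) \<partial>lborel)"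
    unfolding shift_var_def
  proof (intro nn_integral_mono)
    fix z
    have shift: "(1/\<beta>) *\<^sub>R (z + h *\<^sub>R e + qv i) = (1/\<beta>) *\<^sub>R (z + qv i) + u" for i
      by (simp add: u_def algebra_simps)
    have "\<bar>transfer f (z + h *\<^sub>R e) - transfer f z\<bar> \<le> (\<Sum>i<3. G i ((1/\<beta>) *\<^sub>R (z + qv i))) / \<beta>\<^sup>2"
      unfolding transfer_def G_def shift diff_divide_distrib[symmetric] abs_divide sum_subtractf[symmetric]
      by (intro divide_mono sum_abs) (use \<beta> in auto)
    then have "ennreal \<bar>transfer f (z + h *\<^sub>R e) - transfer f z\<bar>
      \<le> ennreal (\<Sum>i<3. G i ((1/\<beta>) *\<^sub>R (z + qv i)) / \<beta>\<^sup>2)"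
      unfolding sum_divide_distrib by (rule ennreal_leI)
    also have "\<dots> = (\<Sum>i<3. ennreal (G i ((1/\<beta>) *\<^sub>R (z + qv i)) / \<beta>\<^sup>2))"
      by (rule sum_ennreal[symmetric]) (simp add: G_def)
    finally show "ennreal \<bar>transfer f (z + h *\<^sub>R e) - transfer f z\<bar> \<le> \<dots>" .
  qed
  also have "\<dots> = (\<Sum>i<3. \<integral>\<^sup>+z. ennreal (G i ((1/\<beta>) *\<^sub>R (z + qv i)) / \<beta>\<^sup>2) \<partial>lborel)"
    by (rule nn_integral_sum) measurable
  also have "\<dots> = (\<Sum>i<3. \<integral>\<^sup>+z. ennreal (G i z) \<partial>lborel)"
  proof (rule sum.cong)
    fix i
    have "(\<integral>\<^sup>+z. ennreal (G i ((1/\<beta>) *\<^sub>R (z + qv i)) / \<beta>\<^sup>2) \<partial>lborel)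
       = ennreal (\<beta>\<^sup>2) * (\<integral>\<^sup>+z. ennreal (G i z / \<beta>\<^sup>2) \<partial>lborel)"
      by (rule nn_integral_inverse_branch) measurable
    also have "\<dots> = (\<integral>\<^sup>+z. ennreal (\<beta>\<^sup>2) * ennreal (G i z / \<beta>\<^sup>2) \<partial>lborel)"
      by (rule nn_integral_cmult[symmetric]) measurable
    also have "\<dots> = (\<integral>\<^sup>+z. ennreal (G i z) \<partial>lborel)"
      using \<beta> by (intro nn_integral_cong) (simp add: ennreal_mult[symmetric] G_def)
    finally show "(\<integral>\<^sup>+z. ennreal (G i ((1/\<beta>) *\<^sub>R (z + qv i)) / \<beta>\<^sup>2) \<partial>lborel)
       = (\<integral>\<^sup>+z. ennreal (G i z) \<partial>lborel)" .
  qed simp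
  also have "\<dots> = (\<integral>\<^sup>+z. (\<Sum>i<3. ennreal (G i z)) \<partial>lborel)"
    by (rule nn_integral_sum[symmetric]) measurable
  also have "\<dots> \<le> (\<integral>\<^sup>+z. ennreal \<bar>f (z + u) - f z\<bar>
      + (3 * (ennreal (f z) * indicator ?s1 z) + 3 * (ennreal (f z) * indicator ?s2 z)) \<partial>lborel)"
  proof (intro nn_integral_mono)
    fix z
    let ?I = "indicator ?s1 z + indicator ?s2 z :: real"
    have "G i z \<le> w i (z + u) * \<bar>f (z + u) - f z\<bar> + f z * ?I" if "i < 3" for i
    proof -
      have "G i z = \<bar>w i (z + u) * (f (z + u) - f z) + (w i (z + u) - w i z) * f z\<bar>"
        unfolding G_def by (simp add: algebra_simps)
      also have "\<dots> \<le> \<bar>w i (z + u) * (f (z + u) - f z)\<bar> + \<bar>(w i (z + u) - w i z) * f z\<bar>"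
        by (rule abs_triangle_ineq)
      also have "\<bar>w i (z + u) * (f (z + u) - f z)\<bar> = w i (z + u) * \<bar>f (z + u) - f z\<bar>"
        by (simp add: abs_mult w_nonneg)
      also have "\<bar>(w i (z + u) - w i z) * f z\<bar> \<le> ?I * f z"
      proof (cases "w i (z + u) = w i z")
        case False
        then have "z \<in> ?s1 \<or> z \<in> ?s2"
          using switch[OF that, of "h / \<beta>" z] h \<beta> unfolding u_def by auto
        then have "1 \<le> ?I" by (auto split: split_indicator)
        moreover have "\<bar>w i (z + u) - w i z\<bar> \<le> 1"
          using w_le_1[OF that, of z] w_le_1[OF that, of "z + u"] w_nonneg[of i z] w_nonneg[of i "z + u"] by linarith
        ultimately show ?thesis
          unfolding abs_mult abs_of_nonneg[OF pos] by (intro mult_right_mono pos) linarith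
      qed (simp add: pos)
      finally show ?thesis by (simp add: mult.commute)
    qed
    then have "(\<Sum>i<3. G i z) \<le> (\<Sum>i<3. w i (z + u) * \<bar>f (z + u) - f z\<bar> + f z * ?I)"
      by (intro sum_mono) auto
    also have "\<dots> = (\<Sum>i<3. w i (z + u)) * \<bar>f (z + u) - f z\<bar> + 3 * (f z * ?I)"
      by (simp add: sum.distrib sum_distrib_right)
    finally have "ennreal (\<Sum>i<3. G i z) \<le> ennreal (\<bar>f (z + u) - f z\<bar>
      + (3 * (f z * indicator ?s1 z) + 3 * (f z * indicator ?s2 z)))"
      by (intro ennreal_leI) (simp add: w_sum algebra_simps)
    also have "\<dots> = ennreal \<bar>f (z + u) - f z\<bar>
      + (3 * (ennreal (f z) * indicator ?s1 z) + 3 * (ennreal (f z) * indicator ?s2 z))"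
      by (simp add: pos ennreal_mult split: split_indicator)
    finally show "(\<Sum>i<3. ennreal (G i z)) \<le> \<dots>"
      by (simp add: sum_ennreal G_def)
  qed
  also have "\<dots> = shift_var u f
     + (3 * (\<integral>\<^sup>+z. ennreal (f z) * indicator ?s1 z \<partial>lborel)
      + 3 * (\<integral>\<^sup>+z. ennreal (f z) * indicator ?s2 z \<partial>lborel))"
    by (simp add: nn_integral_add nn_integral_cmult shift_var_def)
  finally show ?thesis unfolding u_def .
qed

lemma ennreal_combine_bounds:
  fixes a b c d V I :: ennreal
  shows "(a * V + b * I) + (3 * (2 * V + c * I) + 3 * (2 * V + d * I)) = (a + 12) * V + (b + 3 * c + 3 * d) * I"
  by (simp add: algebra_simps) (simp add: distrib_left[symmetric])

text \<open>The outermost step is split off, and its strips are pulled back through the other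
  \<open>n\<close> steps before \<open>strip_bound\<close> is applied. All variation terms thus
  belong to the same \<open>f\<close> at the same scale, so their coefficients add up instead of
  multiplying. Each step adds 12: two strips, three branches, two variations.\<close>

lemma shift_var_funpow_transfer:
  "\<exists>C\<ge>0. \<forall>h>0. \<forall>f. f \<in> borel_measurable borel \<longrightarrow> (\<forall>z. 0 \<le> f z) \<longrightarrow>
    shift_var (h *\<^sub>R e) ((transfer ^^ n) f) \<le> ennreal (1 + 12 * n) * shift_var ((h / \<beta> ^ n) *\<^sub>R e) f
      + ennreal (C * h) * (\<integral>\<^sup>+z. ennreal (f z) \<partial>lborel)"
proof (induction n)
  case 0
  show ?case by (intro exI[of _ 0]) auto
next
  case (Suc n)
  from Suc obtain C where C: "C \<ge> 0" and IH: "\<And>h f. h > 0 \<Longrightarrow> f \<in> borel_measurable borel \<Longrightarrow> \<forall>z. 0 \<le> f z \<Longrightarrow>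
    shift_var (h *\<^sub>R e) ((transfer ^^ n) f) \<le> ennreal (1 + 12 * n) * shift_var ((h / \<beta> ^ n) *\<^sub>R e) f
      + ennreal (C * h) * (\<integral>\<^sup>+z. ennreal (f z) \<partial>lborel)" by blast
  have strip: "\<exists>D\<ge>0. \<forall>h>0. \<forall>f. f \<in> borel_measurable borel \<longrightarrow> (\<forall>z. 0 \<le> f z) \<longrightarrow>
    (\<integral>\<^sup>+z. ennreal ((transfer ^^ n) f z) * indicator (strip \<pi> {c} (h / \<beta>)) z \<partial>lborel)
      \<le> 2 * shift_var ((h / \<beta> ^ Suc n) *\<^sub>R e) f + ennreal (D * h) * (\<integral>\<^sup>+z. ennreal (f z) \<partial>lborel)"
    if lin: "linear \<pi>" and e: "\<pi> e = 1" for \<pi> c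
  proof -
    obtain F where F: "finite F" and 1: "\<And>\<eta> f. f \<in> borel_measurable borel \<Longrightarrow> \<forall>z. 0 \<le> f z \<Longrightarrow>
      (\<integral>\<^sup>+z. ennreal ((transfer ^^ n) f z) * indicator (strip \<pi> {c} \<eta>) z \<partial>lborel)
      \<le> (\<integral>\<^sup>+z. ennreal (f z) * indicator (strip \<pi> F (\<eta> / \<beta> ^ n)) z \<partial>lborel)"
      using funpow_transfer_strip[OF lin, of "{c}" n] by auto
    obtain D where D: "D \<ge> 0" and 2: "\<And>\<eta> f. \<eta> > 0 \<Longrightarrow> f \<in> borel_measurable borel \<Longrightarrow> \<forall>z. 0 \<le> f z \<Longrightarrow>
      (\<integral>\<^sup>+z. ennreal (f z) * indicator (strip \<pi> F \<eta>) z \<partial>lborel)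
      \<le> 2 * shift_var (\<eta> *\<^sub>R e) f + ennreal (D * \<eta>) * (\<integral>\<^sup>+z. ennreal (f z) \<partial>lborel)"
      using strip_bound[OF lin e F] by blast
    show ?thesis
    proof (intro exI[of _ D] conjI allI impI D)
      fix h :: real and f :: "real \<times> real \<Rightarrow> real"
      assume h: "0 < h" and f: "f \<in> borel_measurable borel" "\<forall>z. 0 \<le> f z"
      have "(\<integral>\<^sup>+z. ennreal ((transfer ^^ n) f z) * indicator (strip \<pi> {c} (h / \<beta>)) z \<partial>lborel)
        \<le> (\<integral>\<^sup>+z. ennreal (f z) * indicator (strip \<pi> F (h / \<beta> ^ Suc n)) z \<partial>lborel)"
        using 1[OF f, of "h / \<beta>"] by simp
      also have "\<dots> \<le> 2 * shift_var ((h / \<beta> ^ Suc n) *\<^sub>R e) f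
        + ennreal (D * (h / \<beta> ^ Suc n)) * (\<integral>\<^sup>+z. ennreal (f z) \<partial>lborel)"
        using h \<beta> by (intro 2 f) auto
      also have "\<dots> \<le> 2 * shift_var ((h / \<beta> ^ Suc n) *\<^sub>R e) f + ennreal (D * h) * (\<integral>\<^sup>+z. ennreal (f z) \<partial>lborel)"
      proof (intro add_left_mono mult_right_mono ennreal_leI mult_left_mono D)
        have "1 \<le> \<beta> ^ Suc n" using \<beta> by (intro one_le_power) simp
        then show "h / \<beta> ^ Suc n \<le> h" using h by (simp add: divide_le_eq mult_le_cancel_left1 del: power_Suc)
      qed auto
      finally show "(\<integral>\<^sup>+z. ennreal ((transfer ^^ n) f z) * indicator (strip \<pi> {c} (h / \<beta>)) z \<partial>lborel) \<le> \<dots>" .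
    qed
  qed
  obtain D1 where D1: "D1 \<ge> 0" and s1: "\<And>h f. h > 0 \<Longrightarrow> f \<in> borel_measurable borel \<Longrightarrow> \<forall>z. 0 \<le> f z \<Longrightarrow>
    (\<integral>\<^sup>+z. ennreal ((transfer ^^ n) f z) * indicator (strip \<pi>1 {c1} (h / \<beta>)) z \<partial>lborel)
      \<le> 2 * shift_var ((h / \<beta> ^ Suc n) *\<^sub>R e) f + ennreal (D1 * h) * (\<integral>\<^sup>+z. ennreal (f z) \<partial>lborel)"
    using strip[OF linear(1) unit(1), of c1] by blast
  obtain D2 where D2: "D2 \<ge> 0" and s2: "\<And>h f. h > 0 \<Longrightarrow> f \<in> borel_measurable borel \<Longrightarrow> \<forall>z. 0 \<le> f z \<Longrightarrow>
    (\<integral>\<^sup>+z. ennreal ((transfer ^^ n) f z) * indicator (strip \<pi>2 {c2} (h / \<beta>)) z \<partial>lborel)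
      \<le> 2 * shift_var ((h / \<beta> ^ Suc n) *\<^sub>R e) f + ennreal (D2 * h) * (\<integral>\<^sup>+z. ennreal (f z) \<partial>lborel)"
    using strip[OF linear(2) unit(2), of c2] by blast
  show ?case
  proof (intro exI[of _ "C + 3 * D1 + 3 * D2"] conjI allI impI)
    show "0 \<le> C + 3 * D1 + 3 * D2" using C D1 D2 by simp
    fix h :: real and f :: "real \<times> real \<Rightarrow> real"
    assume h: "0 < h" and f [measurable]: "f \<in> borel_measurable borel" and pos: "\<forall>z. 0 \<le> f z"
    let ?V = "shift_var ((h / \<beta> ^ Suc n) *\<^sub>R e) f" and ?I = "\<integral>\<^sup>+z. ennreal (f z) \<partial>lborel"
    have "shift_var (h *\<^sub>R e) ((transfer ^^ Suc n) f) \<le> shift_var ((h / \<beta>) *\<^sub>R e) ((transfer ^^ n) f)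
     + (3 * (\<integral>\<^sup>+z. ennreal ((transfer ^^ n) f z) * indicator (strip \<pi>1 {c1} (h / \<beta>)) z \<partial>lborel)
      + 3 * (\<integral>\<^sup>+z. ennreal ((transfer ^^ n) f z) * indicator (strip \<pi>2 {c2} (h / \<beta>)) z \<partial>lborel))"
      unfolding funpow.simps o_apply
      by (rule shift_var_transfer) (auto simp: h pos funpow_transfer_nonneg)
    also have "\<dots> \<le> (ennreal (1 + 12 * n) * ?V + ennreal (C * h) * ?I)
      + (3 * (2 * ?V + ennreal (D1 * h) * ?I) + 3 * (2 * ?V + ennreal (D2 * h) * ?I))"
    proof (intro add_mono mult_left_mono s1 s2 h f pos)
      have "shift_var ((h / \<beta>) *\<^sub>R e) ((transfer ^^ n) f) \<le> ennreal (1 + 12 * n) * ?V + ennreal (C * (h / \<beta>)) * ?I"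
        using IH[of "h / \<beta>" f] h \<beta> pos by simp
      also have "\<dots> \<le> ennreal (1 + 12 * n) * ?V + ennreal (C * h) * ?I"
        using h \<beta> C by (intro add_left_mono mult_right_mono ennreal_leI mult_left_mono) (auto simp: divide_le_eq)
      finally show "shift_var ((h / \<beta>) *\<^sub>R e) ((transfer ^^ n) f) \<le> \<dots>" .
    qed auto
    also have "\<dots> = (ennreal (1 + 12 * n) + 12) * ?V + (ennreal (C * h) + 3 * ennreal (D1 * h) + 3 * ennreal (D2 * h)) * ?I"
      by (rule ennreal_combine_bounds)
    also have "ennreal (1 + 12 * n) + 12 = ennreal (1 + 12 * Suc n)"
    proof -
      have "ennreal (1 + 12 * Suc n) = ennreal (real (1 + 12 * n) + 12)" by (simp add: algebra_simps)
      also have "\<dots> = ennreal (1 + 12 * n) + ennreal 12" by (rule ennreal_plus) simp_all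
      finally show ?thesis by simp
    qed
    also have "ennreal (C * h) + 3 * ennreal (D1 * h) + 3 * ennreal (D2 * h) = ennreal ((C + 3 * D1 + 3 * D2) * h)"
    proof -
      have "ennreal ((C + 3 * D1 + 3 * D2) * h) = ennreal (C * h + 3 * (D1 * h) + 3 * (D2 * h))"
        by (simp only: distrib_right mult.assoc)
      also have "\<dots> = ennreal (C * h) + ennreal (3 * (D1 * h)) + ennreal (3 * (D2 * h))"
        using h C D1 D2 by (simp only: ennreal_plus mult_nonneg_nonneg add_nonneg_nonneg less_imp_le zero_le_numeral)
      also have "\<dots> = ennreal (C * h) + 3 * ennreal (D1 * h) + 3 * ennreal (D2 * h)"
        by (simp only: ennreal_mult' ennreal_numeral zero_le_numeral)
      finally show ?thesis by simp
    qed
    finally show "shift_var (h *\<^sub>R e) ((transfer ^^ Suc n) f) \<le> ennreal (1 + 12 * Suc n) * ?V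
      + ennreal ((C + 3 * D1 + 3 * D2) * h) * ?I" .
  qed
qed

text \<open>A linear factor loses against \<open>\<beta> ^ n\<close>, so some iterate contracts the
  variation up to a constant. The bound then propagates in blocks of that length, and the iterates
  within the first block are bounded directly from \<open>M0\<close>.\<close>

lemma shift_var_funpow_transfer_bounded:
  assumes f [measurable]: "f \<in> borel_measurable borel" and pos: "\<And>z. 0 \<le> f z"
    and int: "(\<integral>\<^sup>+z. ennreal (f z) \<partial>lborel) = 1"
    and M0: "0 \<le> M0" "\<And>h. 0 < h \<Longrightarrow> shift_var (h *\<^sub>R e) f \<le> ennreal (M0 * h)"
  shows "\<exists>M\<ge>0. \<forall>n. \<forall>h>0. shift_var (h *\<^sub>R e) ((transfer ^^ n) f) \<le> ennreal (M * h)"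
proof -
  have "(\<lambda>n. 1 / \<beta> ^ n + 12 * (real n / \<beta> ^ n)) \<longlonglongrightarrow> 0 + 12 * 0"
    using \<beta> by (intro tendsto_intros lim_n_over_pown LIMSEQ_divide_realpow_zero) auto
  then have "eventually (\<lambda>n. 1 / \<beta> ^ n + 12 * (real n / \<beta> ^ n) < 1) sequentially"
    by (intro order_tendstoD) auto
  then obtain N0 where N0: "\<And>n. n \<ge> N0 \<Longrightarrow> 1 / \<beta> ^ n + 12 * (real n / \<beta> ^ n) < 1"
    unfolding eventually_sequentially by blast
  \<comment> \<open>The successor makes \<open>N\<close> positive, so that the induction from
    \<open>n\<close> to \<open>n - N\<close> descends.\<close>
  define N where "N = Suc N0"
  define \<theta> where "\<theta> = (1 + 12 * real N) / \<beta> ^ N"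
  have \<theta>: "0 \<le> \<theta>" "\<theta> < 1" using N0[of N] \<beta> by (auto simp: \<theta>_def N_def add_divide_distrib)
  have "\<forall>n. \<exists>C\<ge>0. \<forall>h>0. \<forall>f. f \<in> borel_measurable borel \<longrightarrow> (\<forall>z. 0 \<le> f z) \<longrightarrow>
    shift_var (h *\<^sub>R e) ((transfer ^^ n) f) \<le> ennreal (1 + 12 * n) * shift_var ((h / \<beta> ^ n) *\<^sub>R e) f
      + ennreal (C * h) * (\<integral>\<^sup>+z. ennreal (f z) \<partial>lborel)"
    using shift_var_funpow_transfer by blast
  then obtain C where C: "\<And>n. C n \<ge> 0" and LY: "\<And>n h f. h > 0 \<Longrightarrow> f \<in> borel_measurable borel \<Longrightarrow> \<forall>z. 0 \<le> f z \<Longrightarrow>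
    shift_var (h *\<^sub>R e) ((transfer ^^ n) f) \<le> ennreal (1 + 12 * n) * shift_var ((h / \<beta> ^ n) *\<^sub>R e) f
      + ennreal (C n * h) * (\<integral>\<^sup>+z. ennreal (f z) \<partial>lborel)" by metis
  have step: "shift_var (h *\<^sub>R e) ((transfer ^^ n) g) \<le> ennreal ((((1 + 12 * real n) / \<beta> ^ n) * K + C n) * h)"
    if "h > 0" and [measurable]: "g \<in> borel_measurable borel" and "\<forall>z. 0 \<le> g z" and "(\<integral>\<^sup>+z. ennreal (g z) \<partial>lborel) = 1"
      and K: "0 \<le> K" "\<And>h. h > 0 \<Longrightarrow> shift_var (h *\<^sub>R e) g \<le> ennreal (K * h)" for h n g K
  proof -
    have "shift_var (h *\<^sub>R e) ((transfer ^^ n) g) \<le> ennreal (1 + 12 * real n) * shift_var ((h / \<beta> ^ n) *\<^sub>R e) g + ennreal (C n * h)"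
      using LY[of h g n] that by simp
    also have "\<dots> \<le> ennreal (1 + 12 * real n) * ennreal (K * (h / \<beta> ^ n)) + ennreal (C n * h)"
      using that(1) \<beta> by (intro add_right_mono mult_left_mono K(2)) auto
    also have "\<dots> = ennreal ((1 + 12 * real n) * (K * (h / \<beta> ^ n)) + C n * h)"
      using that(1) \<beta> K(1) C[of n] by (subst ennreal_mult[symmetric]) (auto intro!: ennreal_plus[symmetric] mult_nonneg_nonneg)
    also have "(1 + 12 * real n) * (K * (h / \<beta> ^ n)) + C n * h = (((1 + 12 * real n) / \<beta> ^ n) * K + C n) * h"
      by (simp add: algebra_simps add_divide_distrib)
    finally show ?thesis .
  qed
  define B where "B n = (1 + 12 * real n) / \<beta> ^ n * M0 + C n" for n
  have B: "0 \<le> B n" for n unfolding B_def using M0 \<beta> C by (intro add_nonneg_nonneg mult_nonneg_nonneg) auto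
  \<comment> \<open>The sum dominates the bounds for \<open>n < N\<close>; the second term makes
    \<open>M\<close> satisfy \<open>\<theta> * M + C N \<le> M\<close>.\<close>
  define M where "M = (\<Sum>n<N. B n) + C N / (1 - \<theta>)"
  have M: "0 \<le> M" unfolding M_def using B C \<theta> by (intro add_nonneg_nonneg sum_nonneg) auto
  have closed: "\<theta> * M + C N \<le> M"
  proof -
    have "C N \<le> (1 - \<theta>) * M"
      unfolding M_def using \<theta> B by (simp add: distrib_left sum_nonneg)
    then show ?thesis by (simp add: algebra_simps)
  qed
  have "shift_var (h *\<^sub>R e) ((transfer ^^ n) f) \<le> ennreal (M * h)" if "h > 0" for n h
    using that
  proof (induction n arbitrary: h rule: less_induct)
    case (less n)
    show ?case
    proof (cases "n < N")
      case True
      have "shift_var (h *\<^sub>R e) ((transfer ^^ n) f) \<le> ennreal (B n * h)"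
        unfolding B_def using step[of h f M0 n] less.prems pos int M0 by simp
      also have "\<dots> \<le> ennreal (M * h)"
      proof (intro ennreal_leI mult_right_mono)
        have "B n \<le> (\<Sum>n<N. B n)" using True B by (intro member_le_sum) auto
        moreover have "0 \<le> C N / (1 - \<theta>)" using C[of N] \<theta> by simp
        ultimately show "B n \<le> M" unfolding M_def by linarith
      qed (use less.prems in auto)
      finally show ?thesis .
    next
      case False
      then have eq: "(transfer ^^ n) f = (transfer ^^ N) ((transfer ^^ (n - N)) f)"
        using funpow_add[of N "n - N" transfer] by (simp add: o_def)
      have lt: "n - N < n" using False by (simp add: N_def)
      have "shift_var (h *\<^sub>R e) ((transfer ^^ n) f) \<le> ennreal ((\<theta> * M + C N) * h)"
        unfolding eq \<theta>_def
        by (rule step) (auto simp: less.prems M pos funpow_transfer_nonneg funpow_transfer_integral int intro: less.IH[OF lt])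
      also have "\<dots> \<le> ennreal (M * h)"
        using closed less.prems by (intro ennreal_leI mult_right_mono) auto
      finally show ?thesis .
    qed
  qed
  with M show ?thesis by blast
qed

end

section \<open>Compactness in L1\<close>

text \<open>Completeness of L1 stated for differences only, so the members need not be integrable
  themselves. A fast subsequence has summable increments almost everywhere and converges there;
  Fatou's lemma carries the Cauchy bound over to its limit.\<close>

lemma L1_Cauchy_convergent:
  fixes f :: "nat \<Rightarrow> 'a \<Rightarrow> real"
  assumes [measurable]: "\<And>n. f n \<in> borel_measurable M"
    and Cauchy: "\<And>e. 0 < e \<Longrightarrow> \<exists>N. \<forall>m\<ge>N. \<forall>n\<ge>N. (\<integral>\<^sup>+x. ennreal \<bar>f m x - f n x\<bar> \<partial>M) \<le> ennreal e"
  obtains h where "h \<in> borel_measurable M"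
    "\<forall>e>0. \<exists>N. \<forall>n\<ge>N. (\<integral>\<^sup>+x. ennreal \<bar>f n x - h x\<bar> \<partial>M) \<le> ennreal e"
proof -
  have "\<forall>k. \<exists>N. \<forall>m\<ge>N. \<forall>n\<ge>N. (\<integral>\<^sup>+x. ennreal \<bar>f m x - f n x\<bar> \<partial>M) \<le> ennreal ((1/2) ^ k)"
    by (intro allI Cauchy) simp
  then obtain N where N: "\<And>k m n. m \<ge> N k \<Longrightarrow> n \<ge> N k \<Longrightarrow>
      (\<integral>\<^sup>+x. ennreal \<bar>f m x - f n x\<bar> \<partial>M) \<le> ennreal ((1/2) ^ k)"
    by metis
  \<comment> \<open>Partial sums yield indices beyond \<open>N k\<close> without a recursive choice,
    and the summand \<open>k\<close> drives them to infinity.\<close>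
  define s where "s k = k + (\<Sum>j\<le>k. N j)" for k :: nat
  have s: "N k \<le> s k" "N k \<le> s (Suc k)" "k \<le> s k" for k
    using member_le_sum[of k "{..k}" N] by (auto simp: s_def)
  have "(\<integral>\<^sup>+x. (\<Sum>k. ennreal \<bar>f (s (Suc k)) x - f (s k) x\<bar>) \<partial>M)
      = (\<Sum>k. \<integral>\<^sup>+x. ennreal \<bar>f (s (Suc k)) x - f (s k) x\<bar> \<partial>M)"
    by (rule nn_integral_suminf) measurable
  also have "\<dots> \<le> (\<Sum>k. ennreal ((1/2) ^ k))"
    by (intro suminf_le N s) auto
  also have "\<dots> = ennreal (\<Sum>k. (1/2) ^ k)"
    by (rule suminf_ennreal2) (auto intro: summable_geometric)
  also have "\<dots> < \<infinity>" by simp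
  finally have "AE x in M. (\<Sum>k. ennreal \<bar>f (s (Suc k)) x - f (s k) x\<bar>) \<noteq> \<infinity>"
    by (intro nn_integral_PInf_AE) auto
  then have conv: "AE x in M. convergent (\<lambda>k. f (s k) x)"
  proof eventually_elim
    case (elim x)
    then have "summable (\<lambda>k. \<bar>f (s (Suc k)) x - f (s k) x\<bar>)"
      by (intro summable_suminf_not_top) auto
    then have "summable (\<lambda>k. f (s (Suc k)) x - f (s k) x)"
      by (rule summable_rabs_cancel)
    then have "convergent (\<lambda>n. f (s 0) x + (\<Sum>k<n. f (s (Suc k)) x - f (s k) x))"
      by (intro convergent_add convergent_const) (simp add: summable_iff_convergent)
    moreover have "f (s 0) x + (\<Sum>k<n. f (s (Suc k)) x - f (s k) x) = f (s n) x" for n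
      using sum_lessThan_telescope[of "\<lambda>k. f (s k) x" n] by simp
    ultimately show ?case by simp
  qed
  \<comment> \<open>\<open>lim\<close> is total, so \<open>h\<close> is measurable on the whole
    space; its values matter only where the subsequence converges.\<close>
  define h where "h x = lim (\<lambda>k. f (s k) x)" for x
  have [measurable]: "h \<in> borel_measurable M"
    unfolding h_def by measurable
  show thesis
  proof (rule that[of h]; (intro allI impI)?)
    fix e :: real assume "0 < e"
    then obtain K where K: "\<And>m n. m \<ge> K \<Longrightarrow> n \<ge> K \<Longrightarrow> (\<integral>\<^sup>+x. ennreal \<bar>f m x - f n x\<bar> \<partial>M) \<le> ennreal e"
      using Cauchy by blast
    show "\<exists>N. \<forall>n\<ge>N. (\<integral>\<^sup>+x. ennreal \<bar>f n x - h x\<bar> \<partial>M) \<le> ennreal e"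
    proof (intro exI[of _ K] allI impI)
      fix n assume n: "n \<ge> K"
      have "AE x in M. ennreal \<bar>f n x - h x\<bar> = liminf (\<lambda>k. ennreal \<bar>f n x - f (s k) x\<bar>)"
        using conv
      proof eventually_elim
        case (elim x)
        then have "(\<lambda>k. f (s k) x) \<longlonglongrightarrow> h x"
          unfolding h_def by (simp add: convergent_LIMSEQ_iff)
        then have "(\<lambda>k. ennreal \<bar>f n x - f (s k) x\<bar>) \<longlonglongrightarrow> ennreal \<bar>f n x - h x\<bar>"
          by (intro tendsto_intros)
        then show ?case
          by (intro lim_imp_Liminf[symmetric]) auto
      qed
      then have "(\<integral>\<^sup>+x. ennreal \<bar>f n x - h x\<bar> \<partial>M) = (\<integral>\<^sup>+x. liminf (\<lambda>k. ennreal \<bar>f n x - f (s k) x\<bar>) \<partial>M)"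
        by (rule nn_integral_cong_AE)
      also have "\<dots> \<le> liminf (\<lambda>k. \<integral>\<^sup>+x. ennreal \<bar>f n x - f (s k) x\<bar> \<partial>M)"
        by (rule nn_integral_liminf) measurable
      also have "\<dots> \<le> ennreal e"
      proof (rule Liminf_le)
        show "\<forall>\<^sub>F k in sequentially. (\<integral>\<^sup>+x. ennreal \<bar>f n x - f (s k) x\<bar> \<partial>M) \<le> ennreal e"
          using eventually_ge_at_top[of K]
        proof eventually_elim
          case (elim k)
          then show ?case using s(3)[of k] n by (intro K) auto
        qed
      qed auto
      finally show "(\<integral>\<^sup>+x. ennreal \<bar>f n x - h x\<bar> \<partial>M) \<le> ennreal e" .
    qed
  qed measurable
qed

lemma shift_var_add:
  assumes [measurable]: "f \<in> borel_measurable borel"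
  shows "shift_var (u + v) f \<le> shift_var u f + shift_var v f"
proof -
  have "shift_var (u + v) f \<le> (\<integral>\<^sup>+z. ennreal \<bar>f (z + v + u) - f (z + v)\<bar> + ennreal \<bar>f (z + v) - f z\<bar> \<partial>lborel)"
    unfolding shift_var_def
    by (intro nn_integral_mono) (simp add: ennreal_plus[symmetric] add_ac del: ennreal_plus)
  also have "\<dots> = (\<integral>\<^sup>+z. ennreal \<bar>f (z + v + u) - f (z + v)\<bar> \<partial>lborel) + shift_var v f"
    unfolding shift_var_def by (rule nn_integral_add) measurable
  also have "(\<integral>\<^sup>+z. ennreal \<bar>f (z + v + u) - f (z + v)\<bar> \<partial>lborel) = shift_var u f"
    unfolding shift_var_def
    by (rule nn_integral_lborel_translate[of "\<lambda>z. ennreal \<bar>f (z + u) - f z\<bar>"]) measurable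
  finally show ?thesis .
qed

lemma shift_var_uminus:
  assumes [measurable]: "f \<in> borel_measurable borel"
  shows "shift_var (- u) f = shift_var u f"
  using nn_integral_lborel_translate[of "\<lambda>z. ennreal \<bar>f (z + - u) - f z\<bar>" u]
  by (simp add: shift_var_def abs_minus_commute)

text \<open>Every translation is one along the second axis followed by one along the first. Negative
  amounts reduce to positive ones by translation invariance.\<close>

lemma shift_var_axes:
  fixes f :: "real \<times> real \<Rightarrow> real"
  assumes [measurable]: "f \<in> borel_measurable borel"
    and x: "\<And>h. 0 < h \<Longrightarrow> shift_var (h *\<^sub>R (1, 0)) f \<le> ennreal (M * h)"
    and y: "\<And>h. 0 < h \<Longrightarrow> shift_var (h *\<^sub>R (0, 1)) f \<le> ennreal (M * h)"
    and M: "0 \<le> M"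
  shows "shift_var u f \<le> ennreal (M * (\<bar>fst u\<bar> + \<bar>snd u\<bar>))"
proof -
  have line: "shift_var (a *\<^sub>R e) f \<le> ennreal (M * \<bar>a\<bar>)"
    if "\<And>h. 0 < h \<Longrightarrow> shift_var (h *\<^sub>R e) f \<le> ennreal (M * h)" for a and e :: "real \<times> real"
    using that[of a] that[of "- a"] shift_var_uminus[of f "a *\<^sub>R e"]
    by (cases a "0 :: real" rule: linorder_cases) (auto simp: shift_var_def)
  have "u = fst u *\<^sub>R (1, 0) + snd u *\<^sub>R (0, 1)" by (simp add: prod_eq_iff)
  then have "shift_var u f \<le> shift_var (fst u *\<^sub>R (1, 0)) f + shift_var (snd u *\<^sub>R (0, 1)) f"
    by (metis shift_var_add assms(1))
  also have "\<dots> \<le> ennreal (M * \<bar>fst u\<bar>) + ennreal (M * \<bar>snd u\<bar>)"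
    by (intro add_mono line x y)
  also have "\<dots> = ennreal (M * (\<bar>fst u\<bar> + \<bar>snd u\<bar>))"
    using M by (simp add: ennreal_plus[symmetric] distrib_left del: ennreal_plus)
  finally show ?thesis .
qed

lemma shift_var_diff:
  assumes [measurable]: "f \<in> borel_measurable borel" "g \<in> borel_measurable borel"
  shows "shift_var u (\<lambda>z. f z - g z) \<le> shift_var u f + shift_var u g"
proof -
  have "shift_var u (\<lambda>z. f z - g z) \<le> (\<integral>\<^sup>+z. ennreal \<bar>f (z + u) - f z\<bar> + ennreal \<bar>g (z + u) - g z\<bar> \<partial>lborel)"
    unfolding shift_var_def
    by (intro nn_integral_mono) (simp add: ennreal_plus[symmetric] del: ennreal_plus)
  also have "\<dots> = shift_var u f + shift_var u g"
    unfolding shift_var_def by (rule nn_integral_add) measurable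
  finally show ?thesis .
qed

section \<open>Grid cells and the compactness criterion\<close>

definition cell :: "nat \<Rightarrow> nat \<Rightarrow> nat \<Rightarrow> (real \<times> real) set" where
  "cell m i j = {real i / m ..< real (Suc i) / m} \<times> {real j / m ..< real (Suc j) / m}"

lemma cell_measurable [measurable]: "cell m i j \<in> sets borel"
  unfolding cell_def by (intro borel_Times) auto

lemma emeasure_box_lborel_prod:
  fixes A B :: "real set"
  assumes "A \<in> sets borel" "B \<in> sets borel"
  shows "emeasure lborel (A \<times> B) = emeasure lborel A * emeasure lborel B"
  using lborel.emeasure_pair_measure_Times[of A lborel B] assms by (simp add: lborel_prod)

lemma emeasure_cell: "0 < m \<Longrightarrow> emeasure lborel (cell m i j) = ennreal (1 / (real m)\<^sup>2)"
  unfolding cell_def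
  by (simp add: emeasure_box_lborel_prod ennreal_mult[symmetric] diff_divide_distrib[symmetric] divide_right_mono power2_eq_square)

text \<open>Half-open squares make the cell of a point unique. Nonnegative coordinates matter
  because \<open>nat\<close> sends every negative floor to 0.\<close>

lemma cell_floor:
  assumes "0 < m" "0 \<le> fst z" "0 \<le> snd z"
  shows "z \<in> cell m i j \<longleftrightarrow> i = nat \<lfloor>m * fst z\<rfloor> \<and> j = nat \<lfloor>m * snd z\<rfloor>"
proof -
  have *: "real i / m \<le> x \<and> x < real (Suc i) / m \<longleftrightarrow> i = nat \<lfloor>m * x\<rfloor>" if "0 \<le> x" for i and x :: real
  proof -
    have "real i / m \<le> x \<and> x < real (Suc i) / m \<longleftrightarrow> real i \<le> m * x \<and> m * x < real i + 1"
      using assms(1) by (simp add: field_simps)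
    also have "\<dots> \<longleftrightarrow> \<lfloor>m * x\<rfloor> = int i"
      by (simp add: floor_eq_iff)
    also have "\<dots> \<longleftrightarrow> i = nat \<lfloor>m * x\<rfloor>"
      using that by (auto simp: nat_eq_iff)
    finally show ?thesis .
  qed
  show ?thesis
    using *[OF assms(2), of i] *[OF assms(3), of j] by (auto simp: cell_def mem_Times_iff)
qed


text \<open>At most one cell contains \<open>z\<close>, and a second point of that cell differs from
  \<open>z\<close> by at most 1/m in each coordinate. This replaces a sum of double integrals over
  cells by one integral over short translations, where \<open>shift_var\<close> applies.\<close>

lemma cell_sum_le:
  "(\<Sum>q\<in>A. indicator (cell m (fst q) (snd q)) z * indicator (cell m (fst q) (snd q)) z')
    \<le> (indicator ({-(1/m)..1/m} \<times> {-(1/m)..1/m}) (z' - z) :: ennreal)"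
  if m: "0 < m" and A: "finite A"
proof (cases "\<exists>q\<in>A. z \<in> cell m (fst q) (snd q) \<and> z' \<in> cell m (fst q) (snd q)")
  case True
  then obtain q where q: "q \<in> A" "z \<in> cell m (fst q) (snd q)" "z' \<in> cell m (fst q) (snd q)" by blast
  have nonneg: "0 \<le> fst z" "0 \<le> snd z"
  proof -
    have "real (fst q) / m \<le> fst z" "real (snd q) / m \<le> snd z"
      using q(2) by (simp_all add: cell_def mem_Times_iff)
    then show "0 \<le> fst z" "0 \<le> snd z"
      by (meson divide_nonneg_nonneg of_nat_0_le_iff order_trans)+
  qed
  have uniq: "q' = q" if "z \<in> cell m (fst q') (snd q')" for q'
    using that q(2) by (auto simp: cell_floor[OF m nonneg] prod_eq_iff)
  have "(\<Sum>q\<in>A. indicator (cell m (fst q) (snd q)) z * indicator (cell m (fst q) (snd q)) z')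
    \<le> (\<Sum>q'\<in>A. if q' = q then 1 else (0 :: ennreal))"
  proof (rule sum_mono)
    fix q'
    show "indicator (cell m (fst q') (snd q')) z * indicator (cell m (fst q') (snd q')) z'
      \<le> (if q' = q then 1 else (0 :: ennreal))"
      using uniq[of q'] by (cases "z \<in> cell m (fst q') (snd q')") (simp_all add: indicator_def)
  qed
  also have "\<dots> = 1" using A q(1) by simp
  also have "1 = (indicator ({-(1/m)..1/m} \<times> {-(1/m)..1/m}) (z' - z) :: ennreal)"
  proof -
    have eq: "real (Suc k) / m = real k / m + 1 / m" for k by (simp add: add_divide_distrib)
    have "fst z' - fst z \<in> {-(1/m)..1/m}" "snd z' - snd z \<in> {-(1/m)..1/m}"
      using q(2,3) unfolding cell_def mem_Times_iff fst_conv snd_conv atLeastLessThan_iff atLeastAtMost_iff eq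
      by linarith+
    then show ?thesis by (simp add: mem_Times_iff)
  qed
  finally show ?thesis .
next
  case False
  then have "(\<Sum>q\<in>A. indicator (cell m (fst q) (snd q)) z * indicator (cell m (fst q) (snd q)) z') = (0 :: ennreal)"
    by (intro sum.neutral) (auto split: split_indicator)
  then show ?thesis by simp
qed

text \<open>A Poincare inequality: within a cell, \<open>f\<close> deviates from its mean by an
  average of \<open>\<bar>f z - f z'\<bar>\<close>, which the variation controls. Up to an error of
  order 1/m the norm is thus governed by finitely many cell integrals. Everything is multiplied by
  the cell area \<open>a\<close> to avoid dividing in \<open>ennreal\<close>.\<close>

lemma L1_norm_le_cells:
  fixes f :: "real \<times> real \<Rightarrow> real"
  assumes int: "integrable lborel f"
    and supp: "\<And>z. f z \<noteq> 0 \<Longrightarrow> 0 \<le> fst z \<and> 0 \<le> snd z \<and> m * fst z < L \<and> m * snd z < L"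
    and M: "0 \<le> M" "\<And>u. shift_var u f \<le> ennreal (M * (\<bar>fst u\<bar> + \<bar>snd u\<bar>))"
    and m: "0 < m"
  shows "(\<integral>\<^sup>+z. ennreal \<bar>f z\<bar> \<partial>lborel) \<le> (\<Sum>q\<in>{..<L} \<times> {..<L}.
      ennreal \<bar>\<integral>z. indicator (cell m (fst q) (snd q)) z * f z \<partial>lborel\<bar>) + ennreal (8 * M / m)"
proof -
  define A where "A = {..<L} \<times> {..<L}"
  define Q where "Q q = cell m (fst q) (snd q)" for q
  define a where "a = 1 / (real m)\<^sup>2"
  define B where "B = {-(1/m)..1/m::real} \<times> {-(1/m)..1/m::real}"
  define J where "J q = (\<integral>z. indicator (Q q) z * f z \<partial>lborel)" for q
  have a: "0 < a" using m by (simp add: a_def)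
  have fin: "finite A" by (simp add: A_def)
  have [measurable]: "f \<in> borel_measurable borel" using int by (simp add: borel_measurable_integrable)
  have [measurable]: "Q q \<in> sets borel" for q unfolding Q_def by measurable
  have [measurable]: "B \<in> sets borel" unfolding B_def by (intro borel_Times) auto
  have Q: "emeasure lborel (Q q) = ennreal a" for q
    unfolding Q_def a_def by (rule emeasure_cell[OF m])
  have pointwise: "ennreal (a * \<bar>f z\<bar>) \<le> (\<integral>\<^sup>+z'. ennreal \<bar>f z - f z'\<bar> * indicator (Q q) z' \<partial>lborel) + ennreal \<bar>J q\<bar>" for z q
  proof -
    have i1: "integrable lborel (\<lambda>z'. indicator (Q q) z' * f z)"
      using Q[of q] by (intro integrable_mult_left) (auto intro!: integrable_real_indicator)
    have i2: "integrable lborel (\<lambda>z'. indicator (Q q) z' * f z')"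
      using integrable_mult_indicator[OF _ int, of "Q q"] by simp
    have i3: "integrable lborel (\<lambda>z'. indicator (Q q) z' * f z - indicator (Q q) z' * f z')"
      using i1 i2 by (rule Bochner_Integration.integrable_diff)
    have "measure lborel (Q q) = a" using Q[of q] a by (simp add: measure_def)
    then have "a * f z = (\<integral>z'. indicator (Q q) z' * f z \<partial>lborel)" by simp
    also have "\<dots> = (\<integral>z'. indicator (Q q) z' * f z - indicator (Q q) z' * f z' \<partial>lborel) + J q"
      unfolding J_def using Bochner_Integration.integral_diff[OF i1 i2] by simp
    finally have "a * f z = (\<integral>z'. indicator (Q q) z' * f z - indicator (Q q) z' * f z' \<partial>lborel) + J q" .
    moreover have "a * \<bar>f z\<bar> = \<bar>a * f z\<bar>" using a by (simp add: abs_mult)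
    ultimately have "a * \<bar>f z\<bar> \<le> \<bar>\<integral>z'. indicator (Q q) z' * f z - indicator (Q q) z' * f z' \<partial>lborel\<bar> + \<bar>J q\<bar>"
      by (simp only: abs_triangle_ineq)
    then have "ennreal (a * \<bar>f z\<bar>) \<le> ennreal (\<bar>\<integral>z'. indicator (Q q) z' * f z - indicator (Q q) z' * f z' \<partial>lborel\<bar> + \<bar>J q\<bar>)"
      by (rule ennreal_leI)
    also have "\<dots> = ennreal \<bar>\<integral>z'. indicator (Q q) z' * f z - indicator (Q q) z' * f z' \<partial>lborel\<bar> + ennreal \<bar>J q\<bar>"
      by (rule ennreal_plus) auto
    also have "ennreal \<bar>\<integral>z'. indicator (Q q) z' * f z - indicator (Q q) z' * f z' \<partial>lborel\<bar>
      \<le> (\<integral>\<^sup>+z'. ennreal \<bar>indicator (Q q) z' * f z - indicator (Q q) z' * f z'\<bar> \<partial>lborel)"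
      using integral_norm_bound_ennreal[OF i3] by simp
    also have "\<dots> = (\<integral>\<^sup>+z'. ennreal \<bar>f z - f z'\<bar> * indicator (Q q) z' \<partial>lborel)"
      by (intro nn_integral_cong) (auto split: split_indicator)
    finally show ?thesis by simp
  qed
  have "ennreal a * (\<integral>\<^sup>+z. ennreal \<bar>f z\<bar> \<partial>lborel) = (\<integral>\<^sup>+z. ennreal (a * \<bar>f z\<bar>) \<partial>lborel)"
    using a by (simp add: nn_integral_cmult[symmetric] ennreal_mult)
  also have "\<dots> \<le> (\<integral>\<^sup>+z. (\<Sum>q\<in>A. (\<integral>\<^sup>+z'. ennreal \<bar>f z - f z'\<bar> * (indicator (Q q) z * indicator (Q q) z') \<partial>lborel))
      + (\<Sum>q\<in>A. ennreal \<bar>J q\<bar> * indicator (Q q) z) \<partial>lborel)"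
  proof (intro nn_integral_mono)
    fix z
    show "ennreal (a * \<bar>f z\<bar>) \<le> (\<Sum>q\<in>A. (\<integral>\<^sup>+z'. ennreal \<bar>f z - f z'\<bar> * (indicator (Q q) z * indicator (Q q) z') \<partial>lborel))
      + (\<Sum>q\<in>A. ennreal \<bar>J q\<bar> * indicator (Q q) z)"
    proof (cases "f z = 0")
      case False
      define q where "q = (nat \<lfloor>m * fst z\<rfloor>, nat \<lfloor>m * snd z\<rfloor>)"
      have "z \<in> Q q" unfolding Q_def using supp[OF False] by (simp add: cell_floor[OF m] q_def)
      have "q \<in> A" unfolding A_def q_def using supp[OF False] m by (auto simp: nat_less_iff floor_less_iff)
      have "ennreal (a * \<bar>f z\<bar>) \<le> (\<integral>\<^sup>+z'. ennreal \<bar>f z - f z'\<bar> * (indicator (Q q) z * indicator (Q q) z') \<partial>lborel)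
        + ennreal \<bar>J q\<bar> * indicator (Q q) z"
        using pointwise[of z q] \<open>z \<in> Q q\<close> by simp
      also have "\<dots> \<le> (\<Sum>q\<in>A. (\<integral>\<^sup>+z'. ennreal \<bar>f z - f z'\<bar> * (indicator (Q q) z * indicator (Q q) z') \<partial>lborel))
      + (\<Sum>q\<in>A. ennreal \<bar>J q\<bar> * indicator (Q q) z)"
        by (intro add_mono member_le_sum[OF \<open>q \<in> A\<close>] fin zero_le)
      finally show ?thesis .
    qed simp
  qed
  also have "\<dots> = (\<integral>\<^sup>+z. (\<Sum>q\<in>A. (\<integral>\<^sup>+z'. ennreal \<bar>f z - f z'\<bar> * (indicator (Q q) z * indicator (Q q) z') \<partial>lborel)) \<partial>lborel)
      + (\<integral>\<^sup>+z. (\<Sum>q\<in>A. ennreal \<bar>J q\<bar> * indicator (Q q) z) \<partial>lborel)"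
    by (rule nn_integral_add) measurable
  also have "(\<integral>\<^sup>+z. (\<Sum>q\<in>A. ennreal \<bar>J q\<bar> * indicator (Q q) z) \<partial>lborel) = (\<Sum>q\<in>A. \<integral>\<^sup>+z. ennreal \<bar>J q\<bar> * indicator (Q q) z \<partial>lborel)"
    by (rule nn_integral_sum) measurable
  also have "\<dots> = ennreal a * (\<Sum>q\<in>A. ennreal \<bar>J q\<bar>)"
  proof -
    have "(\<Sum>q\<in>A. \<integral>\<^sup>+z. ennreal \<bar>J q\<bar> * indicator (Q q) z \<partial>lborel) = (\<Sum>q\<in>A. ennreal \<bar>J q\<bar> * ennreal a)"
      by (intro sum.cong refl) (simp add: nn_integral_cmult_indicator Q)
    then show ?thesis
      unfolding sum_distrib_right[symmetric] by (simp only: mult.commute)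
  qed
  also have "(\<integral>\<^sup>+z. (\<Sum>q\<in>A. (\<integral>\<^sup>+z'. ennreal \<bar>f z - f z'\<bar> * (indicator (Q q) z * indicator (Q q) z') \<partial>lborel)) \<partial>lborel)
    \<le> (\<integral>\<^sup>+z. (\<integral>\<^sup>+u. ennreal \<bar>f (z + u) - f z\<bar> * indicator B u \<partial>lborel) \<partial>lborel)"
  proof (rule nn_integral_mono)
    fix z
    have "(\<Sum>q\<in>A. (\<integral>\<^sup>+z'. ennreal \<bar>f z - f z'\<bar> * (indicator (Q q) z * indicator (Q q) z') \<partial>lborel))
      = (\<integral>\<^sup>+z'. (\<Sum>q\<in>A. ennreal \<bar>f z - f z'\<bar> * (indicator (Q q) z * indicator (Q q) z')) \<partial>lborel)"
      by (rule nn_integral_sum[symmetric]) measurable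
    also have "\<dots> \<le> (\<integral>\<^sup>+z'. ennreal \<bar>f z - f z'\<bar> * indicator B (z' - z) \<partial>lborel)"
      unfolding sum_distrib_left[symmetric] B_def Q_def
      by (intro nn_integral_mono mult_left_mono cell_sum_le m fin zero_le)
    also have "\<dots> = (\<integral>\<^sup>+u. ennreal \<bar>f z - f (u + z)\<bar> * indicator B (u + z - z) \<partial>lborel)"
      by (rule nn_integral_lborel_translate[symmetric]) measurable
    finally show "(\<Sum>q\<in>A. (\<integral>\<^sup>+z'. ennreal \<bar>f z - f z'\<bar> * (indicator (Q q) z * indicator (Q q) z') \<partial>lborel))
      \<le> (\<integral>\<^sup>+u. ennreal \<bar>f (z + u) - f z\<bar> * indicator B u \<partial>lborel)"
      by (simp add: add.commute abs_minus_commute)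
  qed
  also have "(\<integral>\<^sup>+z. (\<integral>\<^sup>+u. ennreal \<bar>f (z + u) - f z\<bar> * indicator B u \<partial>lborel) \<partial>lborel)
    = (\<integral>\<^sup>+u. (\<integral>\<^sup>+z. ennreal \<bar>f (z + u) - f z\<bar> * indicator B u \<partial>lborel) \<partial>lborel)"
    by (rule lborel_pair.Fubini') measurable
  also have "\<dots> \<le> (\<integral>\<^sup>+u. ennreal (M * (2 / m)) * indicator B u \<partial>lborel)"
  proof (rule nn_integral_mono)
    fix u :: "real \<times> real"
    have "(\<integral>\<^sup>+z. ennreal \<bar>f (z + u) - f z\<bar> * indicator B u \<partial>lborel) = shift_var u f * indicator B u"
      unfolding shift_var_def by (rule nn_integral_multc) measurable
    also have "\<dots> \<le> ennreal (M * (2 / m)) * indicator B u"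
    proof (cases "u \<in> B")
      case True
      then have "\<bar>fst u\<bar> + \<bar>snd u\<bar> \<le> 2 / m" by (auto simp: B_def mem_Times_iff)
      then have "ennreal (M * (\<bar>fst u\<bar> + \<bar>snd u\<bar>)) \<le> ennreal (M * (2 / m))"
        using M(1) by (intro ennreal_leI mult_left_mono)
      with M(2)[of u] show ?thesis by (intro mult_right_mono) auto
    qed simp
    finally show "(\<integral>\<^sup>+z. ennreal \<bar>f (z + u) - f z\<bar> * indicator B u \<partial>lborel) \<le> \<dots>" .
  qed
  \<comment> \<open>\<open>B\<close> has area \<open>4 * a\<close>, and
    \<open>\<bar>fst u\<bar> + \<bar>snd u\<bar> \<le> 2 / m\<close> on it; the product of 4 and 2
    is the constant 8.\<close>
  also have "\<dots> = ennreal a * ennreal (8 * M / m)"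
  proof -
    have "emeasure lborel B = ennreal (4 * a)"
      unfolding B_def a_def
      by (simp add: emeasure_box_lborel_prod ennreal_mult[symmetric] power2_eq_square)
    then show ?thesis
      using a M(1) by (simp add: nn_integral_cmult_indicator ennreal_mult[symmetric])
  qed
  finally have "ennreal a * (\<integral>\<^sup>+z. ennreal \<bar>f z\<bar> \<partial>lborel)
    \<le> ennreal a * ((\<Sum>q\<in>A. ennreal \<bar>J q\<bar>) + ennreal (8 * M / m))"
    by (simp add: distrib_left add.commute)
  moreover have "ennreal a \<noteq> 0" "ennreal a \<noteq> \<top>" using a by auto
  ultimately have "(\<integral>\<^sup>+z. ennreal \<bar>f z\<bar> \<partial>lborel) \<le> (\<Sum>q\<in>A. ennreal \<bar>J q\<bar>) + ennreal (8 * M / m)"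
    by (simp only: ennreal_mult_le_mult_iff not_False_eq_True)
  then show ?thesis
    by (simp only: A_def J_def Q_def)
qed

text \<open>A form of the Kolmogorov-Riesz criterion. Once all cell integrals converge, the cell
  estimate applied to differences makes the subsequence Cauchy, since the error term is uniform in
  the sequence.\<close>

lemma L1_compact:
  fixes g :: "nat \<Rightarrow> real \<times> real \<Rightarrow> real"
  assumes meas [measurable]: "\<And>n. g n \<in> borel_measurable borel" and pos: "\<And>n z. 0 \<le> g n z"
    and int: "\<And>n. (\<integral>\<^sup>+z. ennreal (g n z) \<partial>lborel) = 1"
    and supp: "\<And>n z. g n z \<noteq> 0 \<Longrightarrow> 0 \<le> fst z \<and> 0 \<le> snd z \<and> fst z \<le> R \<and> snd z \<le> R"
    and M: "0 \<le> M" "\<And>n u. shift_var u (g n) \<le> ennreal (M * (\<bar>fst u\<bar> + \<bar>snd u\<bar>))"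
  obtains r h where "strict_mono (r :: nat \<Rightarrow> nat)" "h \<in> borel_measurable borel"
    "\<forall>e>0. \<exists>N. \<forall>n\<ge>N. (\<integral>\<^sup>+z. ennreal \<bar>g (r n) z - h z\<bar> \<partial>lborel) \<le> ennreal e"
proof -
  have integ: "integrable lborel (g n)" for n
    by (rule integrableI_nonneg) (simp_all add: pos int)
  have integ_cell: "integrable lborel (\<lambda>z. indicator (cell m i j) z * g n z)" for m i j n
    using integrable_mult_indicator[OF _ integ, of "cell m i j"] by simp
  have int1: "integral\<^sup>L lborel (g n) = 1" for n
    by (subst integral_eq_nn_integral) (simp_all add: pos int)
  define J where "J n x = (case x of (m, i, j) \<Rightarrow> \<integral>z. indicator (cell m i j) z * g n z \<partial>lborel)" for n x
  have bound: "norm (J n x) \<le> 1" for n x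
  proof -
    obtain m i j where x: "x = (m, i, j)" by (cases x) auto
    have "0 \<le> J n x" unfolding x J_def by (simp add: pos)
    moreover have "J n x \<le> integral\<^sup>L lborel (g n)"
      unfolding x J_def prod.case
      by (rule integral_mono[OF integ_cell integ]) (auto simp: pos split: split_indicator)
    ultimately show ?thesis by (simp add: int1)
  qed
  \<comment> \<open>Diagonal extraction over the countably many triples \<open>(m, i, j)\<close>: a
    single subsequence serves all mesh sizes at once.\<close>
  obtain r where r: "strict_mono r" and lim: "\<And>x. \<exists>l. (\<lambda>n. J (r n) x) \<longlonglongrightarrow> l"
    using function_convergent_subsequence[of UNIV J 1] bound by auto
  have "\<exists>N. \<forall>k\<ge>N. \<forall>n\<ge>N. (\<integral>\<^sup>+z. ennreal \<bar>g (r k) z - g (r n) z\<bar> \<partial>lborel) \<le> ennreal e" if e: "0 < e" for e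
  proof -
    \<comment> \<open>A difference of two members has variation constant \<open>2 * M\<close>; the
      number 32 brings the error \<open>8 * (2 * M) / m\<close> down to
      \<open>e / 2\<close>.\<close>
    obtain m :: nat where m: "32 * M / e < m" using reals_Archimedean2 by blast
    then have m0: "0 < m" using M(1) e by (cases m) (auto simp: field_simps)
    have small: "8 * (2 * M) / m \<le> e / 2" using m m0 e by (simp add: field_simps)
    obtain L :: nat where L: "m * R < L" using reals_Archimedean2 by blast
    define A where "A = {..<L} \<times> {..<L}"
    have "\<exists>N. \<forall>k\<ge>N. \<forall>n\<ge>N. (\<Sum>q\<in>A. \<bar>J (r k) (m, fst q, snd q) - J (r n) (m, fst q, snd q)\<bar>) \<le> e / 2"
    proof -
      define P where "P N q \<longleftrightarrow> (\<forall>k\<ge>N. \<forall>n\<ge>N.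
          \<bar>J (r k) (m, fst q, snd q) - J (r n) (m, fst q, snd q)\<bar> \<le> e / 2 / (card A + 1))" for N q
      have pos': "0 < e / 2 / (card A + 1)"
        using e by (intro divide_pos_pos) auto
      have "\<exists>N. P N q" for q
      proof -
        have "Cauchy (\<lambda>n. J (r n) (m, fst q, snd q))"
          using lim[of "(m, fst q, snd q)"] LIMSEQ_imp_Cauchy by blast
        from CauchyD[OF this pos'] show ?thesis
          unfolding P_def real_norm_def by (meson less_imp_le)
      qed
      then obtain N where "\<And>q. P (N q) q" by metis
      then have N: "\<bar>J (r k) (m, fst q, snd q) - J (r n) (m, fst q, snd q)\<bar> \<le> e / 2 / (card A + 1)"
        if "k \<ge> N q" "n \<ge> N q" for q k n
        using that unfolding P_def by blast
      have "(\<Sum>q\<in>A. \<bar>J (r k) (m, fst q, snd q) - J (r n) (m, fst q, snd q)\<bar>) \<le> e / 2"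
        if kn: "k \<ge> Max (insert 0 (N ` A))" "n \<ge> Max (insert 0 (N ` A))" for k n
      proof -
        have "(\<Sum>q\<in>A. \<bar>J (r k) (m, fst q, snd q) - J (r n) (m, fst q, snd q)\<bar>) \<le> (\<Sum>q\<in>A. e / 2 / (card A + 1))"
          using kn by (intro sum_mono N) (auto simp: A_def)
        also have "\<dots> \<le> e / 2" using e by (simp add: field_simps)
        finally show ?thesis .
      qed
      then show ?thesis by blast
    qed
    then obtain N where N: "\<And>k n. k \<ge> N \<Longrightarrow> n \<ge> N \<Longrightarrow>
        (\<Sum>q\<in>A. \<bar>J (r k) (m, fst q, snd q) - J (r n) (m, fst q, snd q)\<bar>) \<le> e / 2" by blast
    show ?thesis
    proof (intro exI[of _ N] allI impI)
      fix k n assume kn: "k \<ge> N" "n \<ge> N"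
      define f where "f z = g (r k) z - g (r n) z" for z
      have "(\<integral>\<^sup>+z. ennreal \<bar>f z\<bar> \<partial>lborel) \<le> (\<Sum>q\<in>{..<L} \<times> {..<L}.
          ennreal \<bar>\<integral>z. indicator (cell m (fst q) (snd q)) z * f z \<partial>lborel\<bar>) + ennreal (8 * (2 * M) / m)"
      proof (rule L1_norm_le_cells)
        show "integrable lborel f" unfolding f_def using integ by (intro Bochner_Integration.integrable_diff)
        show "0 \<le> fst z \<and> 0 \<le> snd z \<and> m * fst z < L \<and> m * snd z < L" if "f z \<noteq> 0" for z :: "real \<times> real"
        proof -
          from that have "g (r k) z \<noteq> 0 \<or> g (r n) z \<noteq> 0" by (auto simp: f_def)
          then have z: "0 \<le> fst z" "0 \<le> snd z" "fst z \<le> R" "snd z \<le> R" using supp by blast+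
          have "m * fst z \<le> m * R" "m * snd z \<le> m * R" using z by (auto intro: mult_left_mono)
          with z L show ?thesis by linarith
        qed
        show "shift_var u f \<le> ennreal (2 * M * (\<bar>fst u\<bar> + \<bar>snd u\<bar>))" for u
        proof -
          have "shift_var u f \<le> shift_var u (g (r k)) + shift_var u (g (r n))"
            unfolding f_def by (rule shift_var_diff) measurable
          also have "\<dots> \<le> ennreal (M * (\<bar>fst u\<bar> + \<bar>snd u\<bar>)) + ennreal (M * (\<bar>fst u\<bar> + \<bar>snd u\<bar>))"
            by (intro add_mono M)
          also have "\<dots> = ennreal (2 * M * (\<bar>fst u\<bar> + \<bar>snd u\<bar>))"
            using M(1) by (subst ennreal_plus[symmetric]) (auto simp: algebra_simps)
          finally show ?thesis .
        qed
      qed (use M m0 in auto)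
      also have "(\<Sum>q\<in>{..<L} \<times> {..<L}. ennreal \<bar>\<integral>z. indicator (cell m (fst q) (snd q)) z * f z \<partial>lborel\<bar>)
        = (\<Sum>q\<in>A. ennreal \<bar>J (r k) (m, fst q, snd q) - J (r n) (m, fst q, snd q)\<bar>)"
        unfolding A_def J_def prod.case f_def
        by (intro sum.cong refl) (simp only: Bochner_Integration.integral_diff[OF integ_cell integ_cell, symmetric] right_diff_distrib)
      also have "\<dots> = ennreal (\<Sum>q\<in>A. \<bar>J (r k) (m, fst q, snd q) - J (r n) (m, fst q, snd q)\<bar>)"
        by (rule sum_ennreal) simp
      also have "\<dots> + ennreal (8 * (2 * M) / m) \<le> ennreal (e / 2) + ennreal (e / 2)"
        by (intro add_mono ennreal_leI N kn small)
      also have "\<dots> = ennreal e" using e by (subst ennreal_plus[symmetric]) auto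
      finally show "(\<integral>\<^sup>+z. ennreal \<bar>g (r k) z - g (r n) z\<bar> \<partial>lborel) \<le> ennreal e" by (simp add: f_def)
    qed
  qed
  note Cauchy = this
  have meas': "(\<lambda>z. g (r n) z) \<in> borel_measurable lborel" for n by simp
  obtain h :: "real \<times> real \<Rightarrow> real" where "h \<in> borel_measurable lborel"
    "\<forall>e>0. \<exists>N. \<forall>n\<ge>N. (\<integral>\<^sup>+z. ennreal \<bar>g (r n) z - h z\<bar> \<partial>lborel) \<le> ennreal e"
    by (rule L1_Cauchy_convergent[OF meas' Cauchy])
  with r that show thesis by simp
qed

section \<open>Fixed densities from Cesaro means\<close>

context switched_expansion
begin

lemma transfer_diff: "transfer (\<lambda>z. f z - g z) z = transfer f z - transfer g z"
  by (simp add: transfer_def right_diff_distrib sum_subtractf diff_divide_distrib)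

lemma transfer_mean:
  "transfer (\<lambda>z. (\<Sum>k<n. F k z) / c) z = (\<Sum>k<n. transfer (F k) z) / c"
  unfolding transfer_def sum_divide_distrib sum_distrib_left
  by (subst sum.swap) (simp add: mult.commute)

text \<open>The Krylov-Bogolyubov argument in L1. The means are almost fixed because the sum
  telescopes, and they inherit mass, support and variation bound from the iterates, so
  \<open>L1_compact\<close> supplies a limit point. It is fixed because \<open>transfer\<close> is
  an L1 contraction.\<close>

lemma invariant_density_exists:
  assumes f [measurable]: "f \<in> borel_measurable borel" and pos: "\<And>z. 0 \<le> f z"
    and int: "(\<integral>\<^sup>+z. ennreal (f z) \<partial>lborel) = 1"
    and S [measurable]: "S \<in> sets borel" and supp: "\<And>n z. z \<notin> S \<Longrightarrow> (transfer ^^ n) f z = 0"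
    and box: "\<And>z. z \<in> S \<Longrightarrow> 0 \<le> fst z \<and> 0 \<le> snd z \<and> fst z \<le> R \<and> snd z \<le> R"
    and M: "0 \<le> M" "\<And>n u. shift_var u ((transfer ^^ n) f) \<le> ennreal (M * (\<bar>fst u\<bar> + \<bar>snd u\<bar>))"
  obtains h where "h \<in> borel_measurable borel" "\<And>z. 0 \<le> h z" "\<And>z. z \<notin> S \<Longrightarrow> h z = 0"
    "(\<integral>\<^sup>+z. ennreal (h z) \<partial>lborel) = 1" "AE z in lborel. transfer h z = h z"
proof -
  define F where "F k = (transfer ^^ k) f" for k
  have [measurable]: "F k \<in> borel_measurable borel" for k unfolding F_def by measurable
  have Fpos: "0 \<le> F k z" for k z unfolding F_def by (rule funpow_transfer_nonneg) (rule pos)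
  have Fint: "(\<integral>\<^sup>+z. ennreal (F k z) \<partial>lborel) = 1" for k
    unfolding F_def by (simp add: funpow_transfer_integral pos int)
  have Fsupp: "F k z = 0" if "z \<notin> S" for k z using supp[OF that] by (simp add: F_def)
  have FSuc: "transfer (F k) = F (Suc k)" for k by (simp add: F_def)
  define g where "g n z = (\<Sum>k<Suc n. F k z) / Suc n" for n z
  have [measurable]: "g n \<in> borel_measurable borel" for n unfolding g_def by measurable
  have gpos: "0 \<le> g n z" for n z unfolding g_def by (simp add: sum_nonneg Fpos del: of_nat_Suc)
  have gsupp: "g n z = 0" if "z \<notin> S" for n z unfolding g_def using Fsupp[OF that] by simp
  have mean_le: "(\<integral>\<^sup>+z. ennreal ((\<Sum>k<Suc n. G k z) / Suc n) \<partial>lborel)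
      = ennreal (1 / Suc n) * (\<Sum>k<Suc n. \<integral>\<^sup>+z. ennreal (G k z) \<partial>lborel)"
    if [measurable]: "\<And>k. G k \<in> borel_measurable borel" and "\<And>k z. 0 \<le> G k z"
    for n and G :: "nat \<Rightarrow> real \<times> real \<Rightarrow> real"
  proof -
    have "(\<integral>\<^sup>+z. ennreal ((\<Sum>k<Suc n. G k z) / Suc n) \<partial>lborel)
       = (\<integral>\<^sup>+z. ennreal (1 / Suc n) * (\<Sum>k<Suc n. ennreal (G k z)) \<partial>lborel)"
    proof (rule nn_integral_cong)
      fix z
      have "ennreal ((\<Sum>k<Suc n. G k z) / Suc n) = ennreal (1 / Suc n * (\<Sum>k<Suc n. G k z))" by simp
      also have "\<dots> = ennreal (1 / Suc n) * ennreal (\<Sum>k<Suc n. G k z)"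
        by (rule ennreal_mult') simp
      also have "ennreal (\<Sum>k<Suc n. G k z) = (\<Sum>k<Suc n. ennreal (G k z))"
        by (rule sum_ennreal[symmetric]) (rule that)
      finally show "ennreal ((\<Sum>k<Suc n. G k z) / Suc n) = ennreal (1 / Suc n) * (\<Sum>k<Suc n. ennreal (G k z))" .
    qed
    also have "\<dots> = ennreal (1 / Suc n) * (\<integral>\<^sup>+z. (\<Sum>k<Suc n. ennreal (G k z)) \<partial>lborel)"
      by (rule nn_integral_cmult) measurable
    also have "(\<integral>\<^sup>+z. (\<Sum>k<Suc n. ennreal (G k z)) \<partial>lborel) = (\<Sum>k<Suc n. \<integral>\<^sup>+z. ennreal (G k z) \<partial>lborel)"
      by (rule nn_integral_sum) measurable
    finally show ?thesis .
  qed
  have const: "ennreal (1 / Suc n) * (\<Sum>k<Suc n. ennreal c) = ennreal c" if "0 \<le> c" for n c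
  proof -
    have "(\<Sum>k<Suc n. ennreal c) = ennreal (\<Sum>k<Suc n. c)" by (rule sum_ennreal) (rule that)
    also have "\<dots> = ennreal (real (Suc n) * c)" by simp
    also have "ennreal (1 / Suc n) * \<dots> = ennreal (1 / Suc n * (real (Suc n) * c))"
      by (rule ennreal_mult'[symmetric]) simp
    also have "1 / Suc n * (real (Suc n) * c) = c" by simp
    finally show ?thesis .
  qed
  have gint: "(\<integral>\<^sup>+z. ennreal (g n z) \<partial>lborel) = 1" for n
    unfolding g_def using mean_le[of F n] const[of 1 n] Fpos Fint by simp
  have gM: "shift_var u (g n) \<le> ennreal (M * (\<bar>fst u\<bar> + \<bar>snd u\<bar>))" for n u
  proof -
    have "shift_var u (g n) \<le> (\<integral>\<^sup>+z. ennreal ((\<Sum>k<Suc n. \<bar>F k (z + u) - F k z\<bar>) / Suc n) \<partial>lborel)"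
      unfolding shift_var_def g_def diff_divide_distrib[symmetric] sum_subtractf[symmetric] abs_divide
      by (intro nn_integral_mono ennreal_leI divide_mono sum_abs) auto
    also have "\<dots> = ennreal (1 / Suc n) * (\<Sum>k<Suc n. shift_var u (F k))"
      unfolding shift_var_def by (rule mean_le) auto
    also have "\<dots> \<le> ennreal (1 / Suc n) * (\<Sum>k<Suc n. ennreal (M * (\<bar>fst u\<bar> + \<bar>snd u\<bar>)))"
      unfolding F_def by (intro mult_left_mono sum_mono M) auto
    also have "\<dots> = ennreal (M * (\<bar>fst u\<bar> + \<bar>snd u\<bar>))" using M(1) by (intro const) simp
    finally show ?thesis .
  qed
  have almost_fixed: "(\<integral>\<^sup>+z. ennreal \<bar>transfer (g n) z - g n z\<bar> \<partial>lborel) \<le> ennreal (2 / Suc n)" for n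
  proof -
    have "transfer (g n) z - g n z = (F (Suc n) z - F 0 z) / Suc n" for z
    proof -
      have "transfer (g n) z - g n z = ((\<Sum>k<Suc n. F (Suc k) z) - (\<Sum>k<Suc n. F k z)) / Suc n"
        unfolding g_def transfer_mean FSuc diff_divide_distrib ..
      also have "(\<Sum>k<Suc n. F (Suc k) z) - (\<Sum>k<Suc n. F k z) = F (Suc n) z - F 0 z"
        unfolding sum_subtractf[symmetric] by (rule sum_lessThan_telescope)
      finally show ?thesis .
    qed
    then have "(\<integral>\<^sup>+z. ennreal \<bar>transfer (g n) z - g n z\<bar> \<partial>lborel)
      \<le> (\<integral>\<^sup>+z. ennreal (1 / Suc n) * (ennreal (F (Suc n) z) + ennreal (F 0 z)) \<partial>lborel)"
    proof (intro nn_integral_mono)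
      fix z
      have "\<bar>transfer (g n) z - g n z\<bar> \<le> 1 / Suc n * (F (Suc n) z + F 0 z)"
        using Fpos[of "Suc n" z] Fpos[of 0 z] \<open>\<And>z. transfer (g n) z - g n z = (F (Suc n) z - F 0 z) / Suc n\<close>
        by (auto simp: abs_divide intro!: divide_right_mono)
      then have "ennreal \<bar>transfer (g n) z - g n z\<bar> \<le> ennreal (1 / Suc n * (F (Suc n) z + F 0 z))" by (rule ennreal_leI)
      also have "\<dots> = ennreal (1 / Suc n) * ennreal (F (Suc n) z + F 0 z)"
        by (rule ennreal_mult') simp
      also have "ennreal (F (Suc n) z + F 0 z) = ennreal (F (Suc n) z) + ennreal (F 0 z)"
        by (rule ennreal_plus) (rule Fpos)+
      finally show "ennreal \<bar>transfer (g n) z - g n z\<bar> \<le> ennreal (1 / Suc n) * (ennreal (F (Suc n) z) + ennreal (F 0 z))" .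
    qed
    also have "\<dots> = ennreal (1 / Suc n) * 2"
      by (simp add: nn_integral_cmult nn_integral_add Fint del: of_nat_Suc)
    also have "\<dots> = ennreal (2 / Suc n)"
      by (subst ennreal_numeral[symmetric], subst ennreal_mult'[symmetric]) simp_all
    finally show ?thesis .
  qed
  have "\<exists>(r :: nat \<Rightarrow> nat) h0. strict_mono r \<and> h0 \<in> borel_measurable borel
    \<and> (\<forall>e>0. \<exists>N. \<forall>n\<ge>N. (\<integral>\<^sup>+z. ennreal \<bar>g (r n) z - h0 z\<bar> \<partial>lborel) \<le> ennreal e)"
  proof (rule L1_compact[of g R M])
    show "0 \<le> fst z \<and> 0 \<le> snd z \<and> fst z \<le> R \<and> snd z \<le> R" if "g n z \<noteq> 0" for n z
      using gsupp[of z n] box that by blast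
    fix r' :: "nat \<Rightarrow> nat" and h' :: "real \<times> real \<Rightarrow> real"
    assume "strict_mono r'" "h' \<in> borel_measurable borel"
      "\<forall>e>0. \<exists>N. \<forall>n\<ge>N. (\<integral>\<^sup>+z. ennreal \<bar>g (r' n) z - h' z\<bar> \<partial>lborel) \<le> ennreal e"
    then show "\<exists>(r :: nat \<Rightarrow> nat) h0. strict_mono r \<and> h0 \<in> borel_measurable borel
      \<and> (\<forall>e>0. \<exists>N. \<forall>n\<ge>N. (\<integral>\<^sup>+z. ennreal \<bar>g (r n) z - h0 z\<bar> \<partial>lborel) \<le> ennreal e)"
      by blast
  qed (use gpos gint M(1) gM in auto)
  then obtain r :: "nat \<Rightarrow> nat" and h0 where r: "strict_mono r" and [measurable]: "h0 \<in> borel_measurable borel"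
    and lim0: "\<And>e. 0 < e \<Longrightarrow> \<exists>N. \<forall>n\<ge>N. (\<integral>\<^sup>+z. ennreal \<bar>g (r n) z - h0 z\<bar> \<partial>lborel) \<le> ennreal e"
    by blast
  \<comment> \<open>An L1 limit is determined only almost everywhere. Truncation makes sign and
    support hold at every point, and it does not increase the distance to the means, which are
    nonnegative and vanish off \<open>S\<close>.\<close>
  define h where "h z = indicator S z * max 0 (h0 z)" for z
  have [measurable]: "h \<in> borel_measurable borel" unfolding h_def by measurable
  have hpos: "0 \<le> h z" for z by (simp add: h_def)
  have lim: "\<exists>N. \<forall>n\<ge>N. (\<integral>\<^sup>+z. ennreal \<bar>g (r n) z - h z\<bar> \<partial>lborel) \<le> ennreal e" if "0 < e" for e
  proof -
    have "\<bar>g n z - h z\<bar> \<le> \<bar>g n z - h0 z\<bar>" for n z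
      using gpos[of n z] gsupp[of z n] by (auto simp: h_def indicator_def max_def)
    then have "(\<integral>\<^sup>+z. ennreal \<bar>g n z - h z\<bar> \<partial>lborel) \<le> (\<integral>\<^sup>+z. ennreal \<bar>g n z - h0 z\<bar> \<partial>lborel)" for n
      by (intro nn_integral_mono ennreal_leI)
    with lim0[OF that] show ?thesis by (meson order_trans)
  qed
  have "(\<integral>\<^sup>+z. ennreal (h z) \<partial>lborel) = 1"
  proof (rule antisym)
    have le: "(\<integral>\<^sup>+z. ennreal (a z) \<partial>lborel) \<le> (\<integral>\<^sup>+z. ennreal (b z) \<partial>lborel) + (\<integral>\<^sup>+z. ennreal \<bar>a z - b z\<bar> \<partial>lborel)"
      if [measurable]: "a \<in> borel_measurable borel" "b \<in> borel_measurable borel" and "\<And>z. 0 \<le> b z"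
      for a b :: "real \<times> real \<Rightarrow> real"
    proof -
      have "(\<integral>\<^sup>+z. ennreal (a z) \<partial>lborel) \<le> (\<integral>\<^sup>+z. ennreal (b z) + ennreal \<bar>a z - b z\<bar> \<partial>lborel)"
        using that(3) by (intro nn_integral_mono) (simp add: ennreal_plus[symmetric] ennreal_leI del: ennreal_plus)
      also have "\<dots> = (\<integral>\<^sup>+z. ennreal (b z) \<partial>lborel) + (\<integral>\<^sup>+z. ennreal \<bar>a z - b z\<bar> \<partial>lborel)"
        by (rule nn_integral_add) measurable
      finally show ?thesis .
    qed
    show "(\<integral>\<^sup>+z. ennreal (h z) \<partial>lborel) \<le> 1"
    proof (rule ennreal_le_epsilon)
      fix e :: real assume "0 < e"
      then obtain N where N: "(\<integral>\<^sup>+z. ennreal \<bar>g (r N) z - h z\<bar> \<partial>lborel) \<le> ennreal e" using lim by blast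
      have "(\<integral>\<^sup>+z. ennreal (h z) \<partial>lborel) \<le> 1 + (\<integral>\<^sup>+z. ennreal \<bar>h z - g (r N) z\<bar> \<partial>lborel)"
        using le[of h "g (r N)"] gpos by (simp add: gint)
      with N show "(\<integral>\<^sup>+z. ennreal (h z) \<partial>lborel) \<le> 1 + ennreal e"
        by (simp add: abs_minus_commute) (meson add_left_mono order_trans)
    qed
    show "1 \<le> (\<integral>\<^sup>+z. ennreal (h z) \<partial>lborel)"
    proof (rule ennreal_le_epsilon)
      fix e :: real assume "0 < e"
      then obtain N where N: "(\<integral>\<^sup>+z. ennreal \<bar>g (r N) z - h z\<bar> \<partial>lborel) \<le> ennreal e" using lim by blast
      have "1 \<le> (\<integral>\<^sup>+z. ennreal (h z) \<partial>lborel) + (\<integral>\<^sup>+z. ennreal \<bar>g (r N) z - h z\<bar> \<partial>lborel)"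
        using le[of "g (r N)" h] hpos by (simp add: gint)
      with N show "1 \<le> (\<integral>\<^sup>+z. ennreal (h z) \<partial>lborel) + ennreal e"
        by (meson add_left_mono order_trans)
    qed
  qed
  moreover have "AE z in lborel. transfer h z = h z"
  proof -
    have "(\<integral>\<^sup>+z. ennreal \<bar>transfer h z - h z\<bar> \<partial>lborel) \<le> 0"
    proof (rule ennreal_le_epsilon)
      fix e :: real assume e: "0 < e"
      then obtain N where N: "\<And>n. n \<ge> N \<Longrightarrow> (\<integral>\<^sup>+z. ennreal \<bar>g (r n) z - h z\<bar> \<partial>lborel) \<le> ennreal (e / 3)"
        using lim[of "e / 3"] by auto
      \<comment> \<open>Since \<open>n \<le> r n\<close> for strictly increasing \<open>r\<close>,
        this choice gives \<open>2 / Suc (r n) \<le> e / 3\<close>; the other two thirds come from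
        \<open>N\<close>, one of them through the contraction.\<close>
      obtain n0 :: nat where n0: "6 / e < n0" using reals_Archimedean2 by blast
      define n where "n = max N n0"
      have "n0 \<le> r n" using seq_suble[OF r, of n] by (simp add: n_def)
      then have "6 / e < Suc (r n)" using n0 by linarith
      then have small: "2 / Suc (r n) \<le> e / 3" using e by (simp add: field_simps)
      let ?g = "g (r n)"
      have "(\<integral>\<^sup>+z. ennreal \<bar>transfer h z - h z\<bar> \<partial>lborel)
        \<le> (\<integral>\<^sup>+z. ennreal \<bar>transfer (\<lambda>z. ?g z - h z) z\<bar> + (ennreal \<bar>transfer ?g z - ?g z\<bar> + ennreal \<bar>?g z - h z\<bar>) \<partial>lborel)"
        unfolding transfer_diff
        by (intro nn_integral_mono) (simp add: ennreal_plus[symmetric] ennreal_leI del: ennreal_plus)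
      also have "\<dots> = (\<integral>\<^sup>+z. ennreal \<bar>transfer (\<lambda>z. ?g z - h z) z\<bar> \<partial>lborel)
        + ((\<integral>\<^sup>+z. ennreal \<bar>transfer ?g z - ?g z\<bar> \<partial>lborel) + (\<integral>\<^sup>+z. ennreal \<bar>?g z - h z\<bar> \<partial>lborel))"
        by (simp add: nn_integral_add)
      also have "\<dots> \<le> ennreal (e / 3) + (ennreal (e / 3) + ennreal (e / 3))"
      proof (intro add_mono)
        have "(\<integral>\<^sup>+z. ennreal \<bar>transfer (\<lambda>z. ?g z - h z) z\<bar> \<partial>lborel) \<le> (\<integral>\<^sup>+z. ennreal \<bar>?g z - h z\<bar> \<partial>lborel)"
          by (rule transfer_contraction) measurable
        also have "\<dots> \<le> ennreal (e / 3)" by (rule N) (simp add: n_def)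
        finally show "(\<integral>\<^sup>+z. ennreal \<bar>transfer (\<lambda>z. ?g z - h z) z\<bar> \<partial>lborel) \<le> ennreal (e / 3)" .
        show "(\<integral>\<^sup>+z. ennreal \<bar>transfer ?g z - ?g z\<bar> \<partial>lborel) \<le> ennreal (e / 3)"
          using almost_fixed[of "r n"] ennreal_leI[OF small] by (rule order_trans)
        show "(\<integral>\<^sup>+z. ennreal \<bar>?g z - h z\<bar> \<partial>lborel) \<le> ennreal (e / 3)" by (rule N) (simp add: n_def)
      qed
      also have "\<dots> = 0 + ennreal e"
        using e by (simp add: ennreal_plus[symmetric] del: ennreal_plus)
      finally show "(\<integral>\<^sup>+z. ennreal \<bar>transfer h z - h z\<bar> \<partial>lborel) \<le> 0 + ennreal e" .
    qed
    then have "(\<integral>\<^sup>+z. ennreal \<bar>transfer h z - h z\<bar> \<partial>lborel) = 0" by simp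
    then have "AE z in lborel. ennreal \<bar>transfer h z - h z\<bar> = 0"
      by (subst (asm) nn_integral_0_iff_AE) auto
    then show ?thesis by eventually_elim simp
  qed
  ultimately show thesis
    using that[of h] hpos by (simp add: h_def)
qed

end

section \<open>The random expansion on the triangle\<close>

text \<open>The weights sum to 1 on the whole plane, so the edges of the triangle cause no jumps and the
  variation estimates only meet the three switching lines.\<close>

definition branch_weight :: "real \<Rightarrow> real \<Rightarrow> real \<Rightarrow> real \<Rightarrow> nat \<Rightarrow> real \<times> real \<Rightarrow> real" where
  "branch_weight \<beta> p s t i z =
    (if fst z < 1/\<beta> \<and> snd z < 1/\<beta> then [1, 0, 0]
     else if 1/(\<beta>*(\<beta>-1)) < fst z + snd z then
       (if snd z < 1/\<beta> then [0, 1, 0] else if fst z < 1/\<beta> then [0, 0, 1] else [0, p, 1 - p])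
     else if snd z < 1/\<beta> then [p, 1 - p, 0]
     else if fst z < 1/\<beta> then [p, 0, 1 - p]
     else [s, t, 1 - s - t]) ! min i 2"

lemma nat_less_3_cases: "(i::nat) < 3 \<Longrightarrow> i = 0 \<or> i = 1 \<or> i = 2"
  by auto

lemma branch_weight_measurable [measurable]: "branch_weight \<beta> p s t i \<in> borel_measurable borel"
proof -
  have "min i 2 = 0 \<or> min i 2 = 1 \<or> min i 2 = (2::nat)" by auto
  then show ?thesis
    unfolding borel_prod[symmetric]
    by (elim disjE) (simp_all add: branch_weight_def[abs_def] if_distrib[of "\<lambda>l. l ! _"] cong: if_cong)
qed

lemma sum_lessThan_3: "(\<Sum>i<3. f i) = f 0 + f 1 + f (2::nat)"
  by (simp add: numeral_eq_Suc add_ac)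

text \<open>The clamp \<open>min i 2\<close> in the weights keeps the list index in range, so
  nonnegativity holds for every natural \<open>i\<close>, as the locale demands.\<close>

lemma branch_weight_stochastic:
  fixes p s t :: real
  assumes "0 < p" "p < 1" "0 < s" "0 < t" "s + t < 1"
  shows "0 \<le> branch_weight \<beta> p s t i z" "(\<Sum>i<3. branch_weight \<beta> p s t i z) = 1"
proof -
  have "min i 2 = 0 \<or> min i 2 = 1 \<or> min i 2 = (2::nat)" by auto
  then show "0 \<le> branch_weight \<beta> p s t i z"
    using assms by (elim disjE) (simp_all add: branch_weight_def)
  show "(\<Sum>i<3. branch_weight \<beta> p s t i z) = 1"
    by (simp add: sum_lessThan_3 branch_weight_def)
qed

text \<open>Moving along \<open>(1, 0)\<close> leaves the test on \<open>snd z\<close> unchanged,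
  and each of the two other tests flips only if the segment meets its line.\<close>

lemma branch_weight_switch_fst:
  assumes "0 < \<eta>" "branch_weight \<beta> p s t i (z + \<eta> *\<^sub>R (1, 0)) \<noteq> branch_weight \<beta> p s t i z"
  shows "z \<in> strip fst {1/\<beta>} \<eta> \<or> z \<in> strip (\<lambda>z. fst z + snd z) {1/(\<beta>*(\<beta>-1))} \<eta>"
proof (rule ccontr)
  assume "\<not> ?thesis"
  then have 1: "(fst z + \<eta> < 1/\<beta>) = (fst z < 1/\<beta>)"
    and 2: "(1/(\<beta>*(\<beta>-1)) < fst z + \<eta> + snd z) = (1/(\<beta>*(\<beta>-1)) < fst z + snd z)"
    using assms(1) unfolding strip_def by simp_all linarith+
  note coords = fst_add snd_add fst_scaleR snd_scaleR fst_conv snd_conv real_scaleR_def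
    mult_1_right mult_zero_right add_0_right not_False_eq_True
  show False
    using assms(2) unfolding branch_weight_def by (simp only: coords 1 2)
qed

lemma branch_weight_switch_snd:
  assumes "0 < \<eta>" "branch_weight \<beta> p s t i (z + \<eta> *\<^sub>R (0, 1)) \<noteq> branch_weight \<beta> p s t i z"
  shows "z \<in> strip snd {1/\<beta>} \<eta> \<or> z \<in> strip (\<lambda>z. fst z + snd z) {1/(\<beta>*(\<beta>-1))} \<eta>"
proof (rule ccontr)
  assume "\<not> ?thesis"
  then have 1: "(snd z + \<eta> < 1/\<beta>) = (snd z < 1/\<beta>)"
    and 2: "(1/(\<beta>*(\<beta>-1)) < fst z + (snd z + \<eta>)) = (1/(\<beta>*(\<beta>-1)) < fst z + snd z)"
    using assms(1) unfolding strip_def by simp_all linarith+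
  note coords = fst_add snd_add fst_scaleR snd_scaleR fst_conv snd_conv real_scaleR_def
    mult_1_right mult_zero_right add_0_right not_False_eq_True
  show False
    using assms(2) unfolding branch_weight_def by (simp only: coords 1 2)
qed

lemma Sb_iff: "z \<in> Sb \<beta> \<longleftrightarrow> 0 \<le> fst z \<and> 0 \<le> snd z \<and> fst z + snd z \<le> 1/(\<beta>-1)"
  by (auto simp: Sb_def split: prod.split)

lemma Sb_measurable [measurable]: "Sb \<beta> \<in> sets borel"
proof -
  have "Sb \<beta> = {z \<in> space (borel \<Otimes>\<^sub>M borel :: (real \<times> real) measure). 0 \<le> fst z \<and> 0 \<le> snd z \<and> fst z + snd z \<le> 1/(\<beta>-1)}"
    by (auto simp: Sb_iff space_pair_measure)
  also have "\<dots> \<in> sets (borel \<Otimes>\<^sub>M borel :: (real \<times> real) measure)" by measurable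
  finally show ?thesis unfolding borel_prod .
qed

lemma Tmap_simps:
  "fst (Tmap \<beta> i z) = \<beta> * fst z - (if i = 1 then 1 else 0)"
  "snd (Tmap \<beta> i z) = \<beta> * snd z - (if i = 2 then 1 else 0)"
  by (auto simp: Tmap_def qv_def)

text \<open>Branch \<open>i\<close> expands the copy (S + q_i)/\<beta> of the triangle S onto S. One
  inequality per branch identifies this copy within S; the two others follow from
  \<open>z \<in> Sb \<beta>\<close>, the sum bound by
  \<open>\<beta>/(\<beta>-1) = 1/(\<beta>-1) + 1\<close>.\<close>

lemma Tmap_in_Sb:
  assumes \<beta>: "1 < \<beta>" and z: "z \<in> Sb \<beta>"
    and i1: "i = 1 \<Longrightarrow> 1/\<beta> \<le> fst z" and i2: "i = 2 \<Longrightarrow> 1/\<beta> \<le> snd z"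
    and i0: "i \<noteq> 1 \<Longrightarrow> i \<noteq> 2 \<Longrightarrow> fst z + snd z \<le> 1/(\<beta>*(\<beta>-1))"
  shows "Tmap \<beta> i z \<in> Sb \<beta>"
proof -
  have sum: "\<beta> * fst z + \<beta> * snd z \<le> 1/(\<beta>-1) + 1"
  proof -
    have "\<beta> * (fst z + snd z) \<le> \<beta> * (1/(\<beta>-1))" using z \<beta> by (intro mult_left_mono) (auto simp: Sb_iff)
    also have "\<dots> = 1/(\<beta>-1) + 1" using \<beta> by (simp add: field_simps)
    finally show ?thesis by (simp add: distrib_left)
  qed
  have sum0: "\<beta> * fst z + \<beta> * snd z \<le> 1/(\<beta>-1)" if "i \<noteq> 1" "i \<noteq> 2"
  proof -
    have "\<beta> * (fst z + snd z) \<le> \<beta> * (1/(\<beta>*(\<beta>-1)))" using i0[OF that] \<beta> by (intro mult_left_mono) auto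
    also have "\<dots> = 1/(\<beta>-1)" using \<beta> by simp
    finally show ?thesis by (simp add: distrib_left)
  qed
  have ge: "1 \<le> \<beta> * x" if "1/\<beta> \<le> x" for x
    using that \<beta> by (simp add: divide_le_eq mult.commute)
  have nonneg: "0 \<le> \<beta> * fst z" "0 \<le> \<beta> * snd z" using z \<beta> by (auto simp: Sb_iff)
  show ?thesis
    unfolding Sb_iff Tmap_simps
    using nonneg sum sum0 ge[of "fst z"] ge[of "snd z"] i1 i2 by auto
qed

lemma E0_below_diagonal:
  fixes \<beta> :: real
  assumes "1 < \<beta>" "\<beta> < 3/2" "fst z < 1/\<beta>" "snd z < 1/\<beta>"
  shows "fst z + snd z \<le> 1/(\<beta>*(\<beta>-1))"
proof -
  have "2 \<le> 1 / (\<beta> - 1)" using assms by (simp add: field_simps)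
  then have "1 / \<beta> * 2 \<le> 1 / \<beta> * (1 / (\<beta> - 1))" using assms by (intro mult_left_mono) auto
  then have "1 / \<beta> + 1 / \<beta> \<le> 1/(\<beta>*(\<beta>-1))" by simp
  then show ?thesis using assms(3,4) by linarith
qed

text \<open>A branch with nonzero weight never leaves the triangle. This confines the iterates of
  the starting density, and it allows fibre integrals to be evaluated on the triangle only.\<close>

lemma branch_weight_in_Sb:
  assumes "1 < \<beta>" "\<beta> < 3/2" "z \<in> Sb \<beta>" "i < 3" "branch_weight \<beta> p s t i z \<noteq> 0"
  shows "Tmap \<beta> i z \<in> Sb \<beta>"
proof (rule Tmap_in_Sb[OF assms(1,3)])
  show "1/\<beta> \<le> fst z" if "i = 1"
    using assms(5) unfolding that branch_weight_def by (auto split: if_splits simp: not_less)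
  show "1/\<beta> \<le> snd z" if "i = 2"
    using assms(5) unfolding that branch_weight_def by (auto split: if_splits simp: not_less)
  show "fst z + snd z \<le> 1/(\<beta>*(\<beta>-1))" if "i \<noteq> 1" "i \<noteq> 2"
  proof -
    have "i = 0" using assms(4) that by auto
    then show ?thesis
      using assms(5) E0_below_diagonal[OF assms(1,2), of z] unfolding branch_weight_def by (auto split: if_splits simp: not_less)
  qed
qed

text \<open>Here \<open>a\<close> and \<open>b\<close> are the current symbols of the binary and the ternary sequence.\<close>

definition branch :: "real \<Rightarrow> bool \<Rightarrow> nat \<Rightarrow> real \<times> real \<Rightarrow> nat" where
  "branch \<beta> a b z =
    (if fst z < 1/\<beta> \<and> snd z < 1/\<beta> then 0
     else if 1/(\<beta>*(\<beta>-1)) < fst z + snd z then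
       (if snd z < 1/\<beta> then 1 else if fst z < 1/\<beta> then 2 else if a then 2 else 1)
     else if snd z < 1/\<beta> then (if a then 1 else 0)
     else if fst z < 1/\<beta> then (if a then 2 else 0)
     else b)"

text \<open>Inside the triangle this is the union of \<open>C01\<close>, \<open>C12\<close> and
  \<open>C02\<close>, where \<open>Kb\<close> consumes a binary symbol; \<open>uses_die\<close> is
  \<open>C012\<close>, where it consumes a ternary one.\<close>

definition uses_coin :: "real \<Rightarrow> real \<times> real \<Rightarrow> bool" where
  "uses_coin \<beta> z \<longleftrightarrow> \<not> (fst z < 1/\<beta> \<and> snd z < 1/\<beta>) \<and>
    (if 1/(\<beta>*(\<beta>-1)) < fst z + snd z then \<not> fst z < 1/\<beta> \<and> \<not> snd z < 1/\<beta> else fst z < 1/\<beta> \<or> snd z < 1/\<beta>)"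

definition uses_die :: "real \<Rightarrow> real \<times> real \<Rightarrow> bool" where
  "uses_die \<beta> z \<longleftrightarrow> \<not> fst z < 1/\<beta> \<and> \<not> snd z < 1/\<beta> \<and> \<not> 1/(\<beta>*(\<beta>-1)) < fst z + snd z"

text \<open>The seven regions are Boolean combinations of three tests. \<open>branch\<close> asks
  for \<open>E0\<close> first, as \<open>Kb\<close> does, so both agree for every \<beta> even where
  regions overlap, and the final default of \<open>Kb\<close> is never reached on the
  triangle.\<close>

lemma Kb_eq:
  assumes "z \<in> Sb \<beta>"
  shows "Kb \<beta> (w, v, z) = (if uses_coin \<beta> z then shift w else w,
    if uses_die \<beta> z then shift v else v, Tmap \<beta> (branch \<beta> (w 0) (v 0) z) z)"
proof -
  obtain x y where z: "z = (x, y)" by (cases z)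
  have nonneg: "0 \<le> x" "0 \<le> y" "x + y \<le> 1/(\<beta>-1)" using assms by (auto simp: z Sb_iff)
  define A where "A \<longleftrightarrow> x < 1/\<beta>"
  define B where "B \<longleftrightarrow> y < 1/\<beta>"
  define C where "C \<longleftrightarrow> 1/(\<beta>*(\<beta>-1)) < x + y"
  have mem: "z \<in> E0 \<beta> \<longleftrightarrow> A \<and> B" "z \<in> E1 \<beta> \<longleftrightarrow> B \<and> C" "z \<in> E2 \<beta> \<longleftrightarrow> A \<and> C"
    "z \<in> C01 \<beta> \<longleftrightarrow> \<not> A \<and> B \<and> \<not> C" "z \<in> C12 \<beta> \<longleftrightarrow> \<not> A \<and> \<not> B \<and> C"
    "z \<in> C02 \<beta> \<longleftrightarrow> A \<and> \<not> B \<and> \<not> C" "z \<in> C012 \<beta> \<longleftrightarrow> \<not> A \<and> \<not> B \<and> \<not> C"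
    using assms nonneg by (auto simp: E0_def E1_def E2_def C01_def C12_def C02_def C012_def A_def B_def C_def z not_less)
  have *: "fst z < 1/\<beta> \<longleftrightarrow> A" "snd z < 1/\<beta> \<longleftrightarrow> B" "1/(\<beta>*(\<beta>-1)) < fst z + snd z \<longleftrightarrow> C"
    by (simp_all add: z A_def B_def C_def)
  show ?thesis
    unfolding Kb_def prod.case mem uses_coin_def uses_die_def branch_def *
    by (cases A; cases B; cases C) simp_all
qed

lemma branch_in_Sb:
  assumes "1 < \<beta>" "\<beta> < 3/2" "z \<in> Sb \<beta>"
  shows "Tmap \<beta> (branch \<beta> a b z) z \<in> Sb \<beta>"
  using E0_below_diagonal[OF assms(1,2), of z]
  by (intro Tmap_in_Sb assms) (auto simp: branch_def not_less split: if_splits)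


section \<open>Integrating out the symbol sequences\<close>

lemma shift_measurable [measurable]: "shift \<in> (\<Pi>\<^sub>M i\<in>UNIV. N) \<rightarrow>\<^sub>M (\<Pi>\<^sub>M i\<in>UNIV. N)"
  unfolding shift_def[abs_def]
  by (rule measurable_PiM_single') (auto simp: space_PiM PiE_iff)

text \<open>The product measure is the image of \<open>measure_pmf q \<Otimes>\<^sub>M m\<close>
  under prepending a symbol: the first symbol is independent of the tail, and the tail has the
  original law. The alphabet is countable, so measurability of \<open>F a\<close> for each fixed
  symbol suffices.\<close>

lemma nn_integral_PiM_shift:
  fixes q :: "'a :: countable pmf"
  defines "m \<equiv> \<Pi>\<^sub>M i\<in>(UNIV :: nat set). measure_pmf q"
  assumes F [measurable]: "\<And>a. F a \<in> borel_measurable m"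
  shows "(\<integral>\<^sup>+x. F (x 0) (shift x) \<partial>m) = (\<integral>\<^sup>+a. \<integral>\<^sup>+x. F a x \<partial>m \<partial>measure_pmf q)"
proof -
  interpret sequence_space "measure_pmf q" by unfold_locales
  have [measurable]: "shift \<in> m \<rightarrow>\<^sub>M m" unfolding m_def by measurable
  have [measurable]: "(\<lambda>x. x 0) \<in> m \<rightarrow>\<^sub>M count_space UNIV"
    unfolding m_def using measurable_component_singleton[of 0 UNIV "\<lambda>_. measure_pmf q"] by simp
  have F1 [measurable]: "(\<lambda>x. F (x 0) (shift x)) \<in> borel_measurable m"
    by (rule measurable_compose_countable[where f = "\<lambda>a x. F a (shift x)"]) measurable
  have sets: "sets (measure_pmf q \<Otimes>\<^sub>M m) = sets (count_space UNIV \<Otimes>\<^sub>M m)"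
    by (intro sets_pair_measure_cong) auto
  have F2: "case_prod F \<in> borel_measurable (measure_pmf q \<Otimes>\<^sub>M m)"
    unfolding measurable_cong_sets[OF sets refl]
    by (rule measurable_pair_measure_countable1) auto
  have cons: "(\<lambda>(a, x). case_nat a x) \<in> measure_pmf q \<Otimes>\<^sub>M m \<rightarrow>\<^sub>M m"
    unfolding m_def by measurable
  interpret m: prob_space m unfolding m_def by unfold_locales
  have "(\<integral>\<^sup>+x. F (x 0) (shift x) \<partial>m)
      = (\<integral>\<^sup>+x. F (x 0) (shift x) \<partial>distr (measure_pmf q \<Otimes>\<^sub>M m) m (\<lambda>(a, x). case_nat a x))"
    using PiM_iter by (simp add: m_def)
  also have "\<dots> = (\<integral>\<^sup>+y. F ((case y of (a, x) \<Rightarrow> case_nat a x) 0) (shift (case y of (a, x) \<Rightarrow> case_nat a x)) \<partial>(measure_pmf q \<Otimes>\<^sub>M m))"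
    by (rule nn_integral_distr[OF cons]) (use F1 in simp)
  also have "\<dots> = (\<integral>\<^sup>+y. case_prod F y \<partial>(measure_pmf q \<Otimes>\<^sub>M m))"
    by (intro nn_integral_cong) (auto simp: shift_def split: prod.split)
  also have "\<dots> = (\<integral>\<^sup>+a. \<integral>\<^sup>+x. F a x \<partial>m \<partial>measure_pmf q)"
    using m.nn_integral_fst[OF F2] by simp
  finally show ?thesis .
qed

lemma nn_integral_m1_shift:
  assumes "0 < p" "p < 1" "\<And>a. F a \<in> borel_measurable (m1 p)"
  shows "(\<integral>\<^sup>+x. F (x 0) (shift x) \<partial>m1 p)
    = ennreal p * (\<integral>\<^sup>+x. F False x \<partial>m1 p) + ennreal (1 - p) * (\<integral>\<^sup>+x. F True x \<partial>m1 p)"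
  using nn_integral_PiM_shift[of F "bernoulli_pmf (1 - p)"] assms
  by (simp add: m1_def add.commute mult.commute)

lemma pmf_pmf3:
  assumes "0 < s" "0 < t" "s + t < 1"
  shows "pmf (pmf3 s t) n = (if n = 0 then s else if n = 1 then t else if n = 2 then 1 - s - t else 0)"
  unfolding pmf3_def
proof (rule pmf_embed_pmf)
  let ?f = "\<lambda>n :: nat. if n = 0 then s else if n = 1 then t else if n = 2 then 1 - s - t else 0"
  have "(\<integral>\<^sup>+n. ennreal (?f n) \<partial>count_space UNIV) = (\<Sum>n\<in>{0,1,2}. ennreal (?f n))"
    by (rule nn_integral_count_space') auto
  also have "\<dots> = ennreal (\<Sum>n\<in>{0,1,2}. ?f n)"
    using assms by (intro sum_ennreal) auto
  finally show "(\<integral>\<^sup>+n. ennreal (?f n) \<partial>count_space UNIV) = 1" by simp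
qed (use assms in auto)

lemma nn_integral_m2_shift:
  assumes "0 < s" "0 < t" "s + t < 1" "\<And>a. F a \<in> borel_measurable (m2 s t)"
  shows "(\<integral>\<^sup>+x. F (x 0) (shift x) \<partial>m2 s t)
    = ennreal s * (\<integral>\<^sup>+x. F 0 x \<partial>m2 s t) + ennreal t * (\<integral>\<^sup>+x. F 1 x \<partial>m2 s t)
      + ennreal (1 - s - t) * (\<integral>\<^sup>+x. F 2 x \<partial>m2 s t)"
proof -
  have "(\<integral>\<^sup>+a. f a \<partial>measure_pmf (pmf3 s t)) = (\<Sum>a\<in>{0,1,2}. f a * pmf (pmf3 s t) a)" for f :: "nat \<Rightarrow> ennreal"
    by (rule nn_integral_measure_pmf_support) (auto simp: set_pmf_iff pmf_pmf3[OF assms(1-3)])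
  then show ?thesis
    using nn_integral_PiM_shift[of F "pmf3 s t"] assms
    by (simp add: m2_def pmf_pmf3 add.assoc mult.commute)
qed

lemma branch_deterministic:
  assumes "\<not> uses_coin \<beta> z" "\<not> uses_die \<beta> z"
  shows "\<exists>k<3. (\<forall>a b. branch \<beta> a b z = k) \<and> (\<forall>i<3. branch_weight \<beta> p s t i z = (if i = k then 1 else 0))"
proof -
  have "(\<forall>a b. branch \<beta> a b z = k) \<and> (\<forall>i<3. branch_weight \<beta> p s t i z = (if i = k then 1 else 0))"
    if "k = (if fst z < 1/\<beta> \<and> snd z < 1/\<beta> then 0 else if snd z < 1/\<beta> then 1 else 2)" for k
    using assms that
    by (cases "fst z < 1/\<beta>"; cases "snd z < 1/\<beta>"; cases "1/(\<beta>*(\<beta>-1)) < fst z + snd z")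
       (auto simp: branch_def uses_coin_def uses_die_def branch_weight_def dest!: nat_less_3_cases)
  moreover have "(if fst z < 1/\<beta> \<and> snd z < 1/\<beta> then 0 else if snd z < 1/\<beta> then 1 else 2) < (3::nat)" by simp
  ultimately show ?thesis by blast
qed

lemma branch_coin:
  assumes "uses_coin \<beta> z"
  shows "\<exists>j<3. \<exists>k<3. j \<noteq> k \<and> (\<forall>a b. branch \<beta> a b z = (if a then k else j)) \<and>
    (\<forall>i<3. branch_weight \<beta> p s t i z = (if i = j then p else if i = k then 1 - p else 0))"
proof -
  have "(\<forall>a b. branch \<beta> a b z = (if a then k else j)) \<and>
    (\<forall>i<3. branch_weight \<beta> p s t i z = (if i = j then p else if i = k then 1 - p else 0))"
    if "j = (if 1/(\<beta>*(\<beta>-1)) < fst z + snd z then 1 else 0)" "k = (if snd z < 1/\<beta> then 1 else 2)" for j k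
    using assms that
    by (cases "fst z < 1/\<beta>"; cases "snd z < 1/\<beta>"; cases "1/(\<beta>*(\<beta>-1)) < fst z + snd z")
       (auto simp: branch_def uses_coin_def branch_weight_def dest!: nat_less_3_cases)
  moreover have "(if 1/(\<beta>*(\<beta>-1)) < fst z + snd z then 1 else 0) < (3::nat)" "(if snd z < 1/\<beta> then 1 else 2) < (3::nat)"
    "(if 1/(\<beta>*(\<beta>-1)) < fst z + snd z then 1 else 0) \<noteq> (if snd z < 1/\<beta> then 1 else (2::nat))"
    using assms by (auto simp: uses_coin_def split: if_splits)
  ultimately show ?thesis by blast
qed

lemma branch_die:
  assumes "uses_die \<beta> z"
  shows "\<not> uses_coin \<beta> z" "branch \<beta> a b z = b" "branch_weight \<beta> p s t 0 z = s"
    "branch_weight \<beta> p s t 1 z = t" "branch_weight \<beta> p s t 2 z = 1 - s - t"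
  using assms by (auto simp: uses_die_def uses_coin_def branch_def branch_weight_def)

lemma prob_space_m1: "prob_space (m1 p)" and prob_space_m2: "prob_space (m2 s t)"
  unfolding m1_def m2_def by (intro prob_space_PiM prob_space_measure_pmf)+

text \<open>Either no symbol is read, or the first symbol of one sequence selects the branch and
  only its independent tail is kept. In all three cases the sequences are integrated against the
  same measures as before, and only the branch probabilities remain.\<close>

lemma Kb_fibre_integral:
  assumes par: "1 < \<beta>" "\<beta> < 3/2" "0 < p" "p < 1" "0 < s" "0 < t" "s + t < 1"
    and R: "space R = Sb \<beta>"
    and G [measurable]: "G \<in> borel_measurable (m1 p \<Otimes>\<^sub>M (m2 s t \<Otimes>\<^sub>M R))"
    and z: "z \<in> Sb \<beta>"
  shows "(\<integral>\<^sup>+v. \<integral>\<^sup>+x. G (Kb \<beta> (x, v, z)) \<partial>m1 p \<partial>m2 s t)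
    = (\<Sum>i<3. ennreal (branch_weight \<beta> p s t i z) * (\<integral>\<^sup>+v. \<integral>\<^sup>+x. G (x, v, Tmap \<beta> i z) \<partial>m1 p \<partial>m2 s t))"
proof -
  interpret m1: prob_space "m1 p" by (rule prob_space_m1)
  interpret m2: prob_space "m2 s t" by (rule prob_space_m2)
  define H where "H u = (\<integral>\<^sup>+v. \<integral>\<^sup>+x. G (x, v, u) \<partial>m1 p \<partial>m2 s t)" for u
  have space2: "v \<in> space (m2 s t)" for v by (simp add: m2_def space_PiM)
  have G1 [measurable]: "(\<lambda>x. G (x, v, u)) \<in> borel_measurable (m1 p)" if "u \<in> Sb \<beta>" for u v
    using that R space2[of v] by (intro measurable_compose[OF measurable_Pair2' G, of "(v, u)", simplified o_def]) (simp add: space_pair_measure)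
  have G2 [measurable]: "(\<lambda>v. \<integral>\<^sup>+x. G (x, v, u) \<partial>m1 p) \<in> borel_measurable (m2 s t)" if "u \<in> Sb \<beta>" for u
  proof -
    have [measurable]: "u \<in> space R" using that R by simp
    show ?thesis by measurable
  qed
  have lin: "(\<integral>\<^sup>+v. a * f v + b * g v \<partial>m2 s t) = a * (\<integral>\<^sup>+v. f v \<partial>m2 s t) + b * (\<integral>\<^sup>+v. g v \<partial>m2 s t)"
    if [measurable]: "f \<in> borel_measurable (m2 s t)" "g \<in> borel_measurable (m2 s t)" for f g a b
    by (simp add: nn_integral_add nn_integral_cmult)
  have "(\<integral>\<^sup>+v. \<integral>\<^sup>+x. G (Kb \<beta> (x, v, z)) \<partial>m1 p \<partial>m2 s t) = (\<Sum>i<3. ennreal (branch_weight \<beta> p s t i z) * H (Tmap \<beta> i z))"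
  proof (cases "uses_die \<beta> z")
    case True
    \<comment> \<open>All natural \<open>a\<close> are needed, since
      \<open>nn_integral_m2_shift\<close> asks for measurability at every symbol. Beyond 2 the
      vector \<open>qv a\<close> is zero, so such symbols act like 0.\<close>
    have T: "Tmap \<beta> a z \<in> Sb \<beta>" for a
      using branch_in_Sb[OF par(1,2) z, of True a] by (simp add: branch_die[OF True])
    have "(\<integral>\<^sup>+v. \<integral>\<^sup>+x. G (Kb \<beta> (x, v, z)) \<partial>m1 p \<partial>m2 s t)
      = (\<integral>\<^sup>+v. (\<lambda>a v. \<integral>\<^sup>+x. G (x, v, Tmap \<beta> a z) \<partial>m1 p) (v 0) (shift v) \<partial>m2 s t)"
      by (simp add: Kb_eq[OF z] branch_die[OF True] True)
    also have "\<dots> = ennreal s * H (Tmap \<beta> 0 z) + ennreal t * H (Tmap \<beta> 1 z) + ennreal (1 - s - t) * H (Tmap \<beta> 2 z)"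
      unfolding H_def by (rule nn_integral_m2_shift) (use par G2[OF T] in auto)
    finally show ?thesis by (simp add: sum_lessThan_3 branch_die[OF True] del: One_nat_def)
  next
    case no_die: False
    show ?thesis
    proof (cases "uses_coin \<beta> z")
      case True
      obtain j k where jk: "j < 3" "k < 3" "j \<noteq> k" and br: "\<And>a b. branch \<beta> a b z = (if a then k else j)"
        and wt: "\<And>i. i < 3 \<Longrightarrow> branch_weight \<beta> p s t i z = (if i = j then p else if i = k then 1 - p else 0)"
        using branch_coin[OF True, of p s t] by blast
      have T: "Tmap \<beta> j z \<in> Sb \<beta>" "Tmap \<beta> k z \<in> Sb \<beta>"
        using branch_in_Sb[OF par(1,2) z, of False 0] branch_in_Sb[OF par(1,2) z, of True 0] by (simp_all add: br)
      have "(\<integral>\<^sup>+x. G (Kb \<beta> (x, v, z)) \<partial>m1 p) = ennreal p * (\<integral>\<^sup>+x. G (x, v, Tmap \<beta> j z) \<partial>m1 p)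
         + ennreal (1 - p) * (\<integral>\<^sup>+x. G (x, v, Tmap \<beta> k z) \<partial>m1 p)" for v
        using nn_integral_m1_shift[OF par(3,4), of "\<lambda>a x. G (x, v, Tmap \<beta> (if a then k else j) z)"] T
        by (simp add: Kb_eq[OF z] br True no_die G1)
      then have "(\<integral>\<^sup>+v. \<integral>\<^sup>+x. G (Kb \<beta> (x, v, z)) \<partial>m1 p \<partial>m2 s t) = ennreal p * H (Tmap \<beta> j z) + ennreal (1 - p) * H (Tmap \<beta> k z)"
        unfolding H_def using lin[OF G2[OF T(1)] G2[OF T(2)]] by simp
      also have "\<dots> = (\<Sum>i<3. ennreal (branch_weight \<beta> p s t i z) * H (Tmap \<beta> i z))"
      proof -
        have "(\<Sum>i<3. ennreal (branch_weight \<beta> p s t i z) * H (Tmap \<beta> i z))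
          = (\<Sum>i\<in>{j, k}. ennreal (branch_weight \<beta> p s t i z) * H (Tmap \<beta> i z))"
          using jk wt by (intro sum.mono_neutral_right) auto
        then show ?thesis using jk wt by simp
      qed
      finally show ?thesis .
    next
      case False
      obtain k where k: "k < 3" and br: "\<And>a b. branch \<beta> a b z = k"
        and wt: "\<And>i. i < 3 \<Longrightarrow> branch_weight \<beta> p s t i z = (if i = k then 1 else 0)"
        using branch_deterministic[OF False no_die, of p s t] by blast
      have "(\<Sum>i<3. ennreal (branch_weight \<beta> p s t i z) * H (Tmap \<beta> i z))
        = (\<Sum>i\<in>{k}. ennreal (branch_weight \<beta> p s t i z) * H (Tmap \<beta> i z))"
        using k wt by (intro sum.mono_neutral_right) auto
      then show ?thesis
        using k wt by (simp add: Kb_eq[OF z] br False no_die H_def)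
    qed
  qed
  then show ?thesis unfolding H_def .
qed

text \<open>\<open>Kb_eq\<close> holds on the triangle only, which is all that measurability on the
  product space sees. The branch index has countable range, so each fixed branch can be treated
  separately.\<close>

lemma Kb_measurable:
  assumes par: "1 < \<beta>" "\<beta> < 3/2" and R: "sets R = sets (restrict_space borel (Sb \<beta>))"
  shows "Kb \<beta> \<in> m1 p \<Otimes>\<^sub>M (m2 s t \<Otimes>\<^sub>M R) \<rightarrow>\<^sub>M m1 p \<Otimes>\<^sub>M (m2 s t \<Otimes>\<^sub>M R)"
proof -
  let ?N = "m1 p \<Otimes>\<^sub>M (m2 s t \<Otimes>\<^sub>M R)"
  have spR: "space R = Sb \<beta>" using sets_eq_imp_space_eq[OF R] by (simp add: space_restrict_space)
  have idR: "(\<lambda>z. z) \<in> R \<rightarrow>\<^sub>M borel \<Otimes>\<^sub>M borel"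
    unfolding measurable_cong_sets[OF R refl] borel_prod by (rule measurable_restrict_space1) simp
  have [measurable]: "(\<lambda>x. snd (snd x)) \<in> ?N \<rightarrow>\<^sub>M borel \<Otimes>\<^sub>M borel"
    using measurable_compose[OF _ idR, of "\<lambda>x. snd (snd x)" ?N] by simp
  have [measurable]: "(\<lambda>x. fst (snd (snd x))) \<in> ?N \<rightarrow>\<^sub>M borel" "(\<lambda>x. snd (snd (snd x))) \<in> ?N \<rightarrow>\<^sub>M borel"
    by measurable
  have [measurable]: "shift \<in> m1 p \<rightarrow>\<^sub>M m1 p" "shift \<in> m2 s t \<rightarrow>\<^sub>M m2 s t"
    unfolding m1_def m2_def by measurable
  have c1: "(\<lambda>x. x 0) \<in> m1 p \<rightarrow>\<^sub>M count_space UNIV"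
    unfolding m1_def using measurable_component_singleton[of 0 UNIV "\<lambda>_. measure_pmf (bernoulli_pmf (1 - p))"] by simp
  have c2: "(\<lambda>x. x 0) \<in> m2 s t \<rightarrow>\<^sub>M count_space UNIV"
    unfolding m2_def using measurable_component_singleton[of 0 UNIV "\<lambda>_. measure_pmf (pmf3 s t)"] by simp
  have [measurable]: "(\<lambda>x. fst x 0) \<in> ?N \<rightarrow>\<^sub>M count_space UNIV" "(\<lambda>x. fst (snd x) 0) \<in> ?N \<rightarrow>\<^sub>M count_space UNIV"
    using measurable_compose[OF _ c1, of fst ?N] measurable_compose[OF _ c2, of "\<lambda>x. fst (snd x)" ?N] by simp_all
  have br [measurable]: "(\<lambda>x. branch \<beta> (fst x 0) (fst (snd x) 0) (snd (snd x))) \<in> ?N \<rightarrow>\<^sub>M count_space UNIV"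
    unfolding branch_def by measurable
  have T: "(\<lambda>x. Tmap \<beta> (branch \<beta> (fst x 0) (fst (snd x) 0) (snd (snd x))) (snd (snd x))) \<in> ?N \<rightarrow>\<^sub>M borel"
  proof (rule measurable_compose_countable[OF _ br])
    fix i
    have "(\<lambda>x. snd (snd x)) \<in> ?N \<rightarrow>\<^sub>M borel" unfolding borel_prod[symmetric] by measurable
    then show "(\<lambda>x. Tmap \<beta> i (snd (snd x))) \<in> ?N \<rightarrow>\<^sub>M borel"
      unfolding Tmap_def by measurable
  qed
  have TR: "(\<lambda>x. Tmap \<beta> (branch \<beta> (fst x 0) (fst (snd x) 0) (snd (snd x))) (snd (snd x))) \<in> ?N \<rightarrow>\<^sub>M R"
    unfolding measurable_cong_sets[OF refl R]
    by (rule measurable_restrict_space2[OF _ T]) (auto simp: space_pair_measure spR intro!: branch_in_Sb par)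
  have [measurable]: "Measurable.pred ?N (\<lambda>x. uses_coin \<beta> (snd (snd x)))" "Measurable.pred ?N (\<lambda>x. uses_die \<beta> (snd (snd x)))"
    unfolding uses_coin_def uses_die_def by measurable
  have "(\<lambda>x. (if uses_coin \<beta> (snd (snd x)) then shift (fst x) else fst x,
      if uses_die \<beta> (snd (snd x)) then shift (fst (snd x)) else fst (snd x),
      Tmap \<beta> (branch \<beta> (fst x 0) (fst (snd x) 0) (snd (snd x))) (snd (snd x)))) \<in> ?N \<rightarrow>\<^sub>M ?N"
    by (intro measurable_Pair TR) measurable
  then show ?thesis
    by (rule measurable_cong[THEN iffD1, rotated]) (auto simp: space_pair_measure spR Kb_eq)
qed

section \<open>Starting density and fixed density on the triangle\<close>

lemma shift_var_unit_square:
  assumes "0 < h"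
  shows "shift_var (h *\<^sub>R (1 :: real, 0 :: real)) (indicator ({0..1} \<times> {0..1})) \<le> ennreal (2 * h)"
    "shift_var (h *\<^sub>R (0 :: real, 1 :: real)) (indicator ({0..1} \<times> {0..1})) \<le> ennreal (2 * h)"
proof -
  \<comment> \<open>\<open>A\<close> and \<open>B\<close> are slabs of area \<open>h\<close> at the
    edge that the shift opens and at the one it closes; together they cover the symmetric
    difference, also for large \<open>h\<close>.\<close>
  have bound: "shift_var u (indicator ({0..1} \<times> {0..1})) \<le> ennreal (2 * h)"
    if AB: "A \<in> sets borel" "B \<in> sets borel" "emeasure lborel A = ennreal h" "emeasure lborel B = ennreal h"
      and le: "\<And>z. \<bar>indicator ({0..1} \<times> {0..1}) (z + u) - indicator ({0..1} \<times> {0..1}) z :: real\<bar> \<le> indicator A z + indicator B z"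
    for u and A B :: "(real \<times> real) set"
  proof -
    note [measurable] = AB(1,2)
    have "shift_var u (indicator ({0..1} \<times> {0..1})) \<le> (\<integral>\<^sup>+z. indicator A z + indicator B z \<partial>lborel)"
      unfolding shift_var_def
    proof (rule nn_integral_mono)
      fix z
      have "ennreal \<bar>indicator ({0..1} \<times> {0..1}) (z + u) - indicator ({0..1} \<times> {0..1}) z\<bar> \<le> ennreal (indicator A z + indicator B z)"
        using le by (rule ennreal_leI)
      also have "\<dots> = indicator A z + indicator B z" by (auto split: split_indicator)
      finally show "ennreal \<bar>indicator ({0..1} \<times> {0..1}) (z + u) - indicator ({0..1} \<times> {0..1}) z\<bar> \<le> indicator A z + indicator B z" .
    qed
    also have "\<dots> = emeasure lborel A + emeasure lborel B"
      by (simp add: nn_integral_add)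
    also have "\<dots> = ennreal (2 * h)"
      using assms AB by (simp add: ennreal_plus[symmetric] del: ennreal_plus)
    finally show ?thesis .
  qed
  show "shift_var (h *\<^sub>R (1 :: real, 0 :: real)) (indicator ({0..1} \<times> {0..1})) \<le> ennreal (2 * h)"
    by (intro bound[of "{-h..0} \<times> {0..1}" "{1-h..1} \<times> {0..1}"] borel_Times)
      (use assms in \<open>auto simp: emeasure_box_lborel_prod split: split_indicator\<close>)
  show "shift_var (h *\<^sub>R (0 :: real, 1 :: real)) (indicator ({0..1} \<times> {0..1})) \<le> ennreal (2 * h)"
    by (intro bound[of "{0..1} \<times> {-h..0}" "{0..1} \<times> {1-h..1}"] borel_Times)
      (use assms in \<open>auto simp: emeasure_box_lborel_prod split: split_indicator\<close>)
qed

lemma Sb_invariant_density: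
  assumes par: "1 < \<beta>" "\<beta> < 3/2" "0 < p" "p < 1" "0 < s" "0 < t" "s + t < 1"
  obtains h where "h \<in> borel_measurable borel" "\<And>z. 0 \<le> h z" "\<And>z. z \<notin> Sb \<beta> \<Longrightarrow> h z = 0"
    "(\<integral>\<^sup>+z. ennreal (h z) \<partial>lborel) = 1"
    "AE z in lborel. switched_expansion.transfer \<beta> (branch_weight \<beta> p s t) h z = h z"
proof -
  let ?w = "branch_weight \<beta> p s t"
  interpret switched_expansion \<beta> ?w
    by (intro switched_expansion.intro par(1) branch_weight_measurable branch_weight_stochastic[OF par(3-7)])
  have lin: "linear (fst :: real \<times> real \<Rightarrow> real)" "linear (snd :: real \<times> real \<Rightarrow> real)"
    "linear (\<lambda>z :: real \<times> real. fst z + snd z)"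
    by (auto intro!: linearI simp: algebra_simps)
  interpret X: two_strip_expansion \<beta> ?w "(1, 0)" fst "\<lambda>z. fst z + snd z" "1/\<beta>" "1/(\<beta>*(\<beta>-1))"
    by (intro two_strip_expansion.intro two_strip_expansion_axioms.intro switched_expansion_axioms lin branch_weight_switch_fst)
       simp_all
  interpret Y: two_strip_expansion \<beta> ?w "(0, 1)" snd "\<lambda>z. fst z + snd z" "1/\<beta>" "1/(\<beta>*(\<beta>-1))"
    by (intro two_strip_expansion.intro two_strip_expansion_axioms.intro switched_expansion_axioms lin branch_weight_switch_snd)
       simp_all
  define f :: "real \<times> real \<Rightarrow> real" where "f = indicator ({0..1} \<times> {0..1})"
  have [measurable]: "{0..1::real} \<times> {0..1::real} \<in> sets borel" by (intro borel_Times) auto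
  have f [measurable]: "f \<in> borel_measurable borel" unfolding f_def by measurable
  have pos: "0 \<le> f z" for z by (simp add: f_def)
  have int: "(\<integral>\<^sup>+z. ennreal (f z) \<partial>lborel) = 1"
    unfolding f_def by (simp add: ennreal_indicator emeasure_box_lborel_prod)
  have supp: "(transfer ^^ n) f z = 0" if "z \<notin> Sb \<beta>" for n z
    using that
  proof (induction n arbitrary: z)
    case 0
    have "2 \<le> 1/(\<beta>-1)" using par by (simp add: field_simps)
    with 0 show ?case by (auto simp: f_def Sb_iff indicator_def mem_Times_iff)
  next
    case (Suc n)
    \<comment> \<open>A nonzero term needs a preimage in the triangle with nonzero weight, and then
      its image \<open>z\<close> lies in the triangle too.\<close>
    have "?w i ((1/\<beta>) *\<^sub>R (z + qv i)) * (transfer ^^ n) f ((1/\<beta>) *\<^sub>R (z + qv i)) = 0" if "i < 3" for i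
    proof (rule ccontr)
      assume *: "\<not> ?thesis"
      then have "(1/\<beta>) *\<^sub>R (z + qv i) \<in> Sb \<beta>" using Suc.IH by fastforce
      then have "Tmap \<beta> i ((1/\<beta>) *\<^sub>R (z + qv i)) \<in> Sb \<beta>"
        using * by (intro branch_weight_in_Sb[OF par(1,2) _ that]) auto
      with Suc.prems show False by simp
    qed
    then have "transfer ((transfer ^^ n) f) z = 0" by (subst transfer_def) (simp add: sum.neutral del: mult_eq_0_iff)
    then show ?case by simp
  qed
  obtain M1 where M1: "0 \<le> M1" "\<And>n h. 0 < h \<Longrightarrow> shift_var (h *\<^sub>R (1, 0)) ((transfer ^^ n) f) \<le> ennreal (M1 * h)"
    using X.shift_var_funpow_transfer_bounded[OF f pos int, of 2] shift_var_unit_square(1) by (auto simp: f_def)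
  obtain M2 where M2: "0 \<le> M2" "\<And>n h. 0 < h \<Longrightarrow> shift_var (h *\<^sub>R (0, 1)) ((transfer ^^ n) f) \<le> ennreal (M2 * h)"
    using Y.shift_var_funpow_transfer_bounded[OF f pos int, of 2] shift_var_unit_square(2) by (auto simp: f_def)
  have M: "shift_var u ((transfer ^^ n) f) \<le> ennreal ((M1 + M2) * (\<bar>fst u\<bar> + \<bar>snd u\<bar>))" for n u
  proof (rule shift_var_axes)
    show "shift_var (h *\<^sub>R (1, 0)) ((transfer ^^ n) f) \<le> ennreal ((M1 + M2) * h)" if "0 < h" for h
      by (rule order_trans[OF M1(2)[OF that]]) (use M2(1) that in \<open>auto intro!: ennreal_leI mult_right_mono\<close>)
    show "shift_var (h *\<^sub>R (0, 1)) ((transfer ^^ n) f) \<le> ennreal ((M1 + M2) * h)" if "0 < h" for h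
      by (rule order_trans[OF M2(2)[OF that]]) (use M1(1) that in \<open>auto intro!: ennreal_leI mult_right_mono\<close>)
  qed (use M1 M2 in auto)
  show thesis
  proof (rule invariant_density_exists[OF f pos int Sb_measurable supp _ _ M])
    show "0 \<le> fst z \<and> 0 \<le> snd z \<and> fst z \<le> 1/(\<beta>-1) \<and> snd z \<le> 1/(\<beta>-1)" if "z \<in> Sb \<beta>" for z
      using that by (auto simp: Sb_iff)
    show "0 \<le> M1 + M2" using M1 M2 by simp
  qed (assumption, rule that, blast+)
qed

section \<open>Invariance of the product measure\<close>

theorem theorem5p7:
  fixes \<beta> p s t :: real
  assumes "1 < \<beta>" "\<beta> < 3/2" "0 < p" "p < 1" "0 < s" "0 < t" "s + t < 1"
  shows "\<exists>\<mu> :: (real \<times> real) measure.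
           prob_space \<mu> \<and> sets \<mu> = sets (lambda2 \<beta>) \<and>
           absolutely_continuous (lambda2 \<beta>) \<mu> \<and>
           invariant_measure (m1 p \<Otimes>\<^sub>M (m2 s t \<Otimes>\<^sub>M \<mu>)) (Kb \<beta>)"
proof -
  let ?S = "Sb \<beta>" and ?w = "branch_weight \<beta> p s t"
  interpret switched_expansion \<beta> ?w
    by (intro switched_expansion.intro assms(1) branch_weight_measurable branch_weight_stochastic[OF assms(3-7)])
  obtain h where [measurable]: "h \<in> borel_measurable borel" and pos: "\<And>z. 0 \<le> h z"
    and supp: "\<And>z. z \<notin> ?S \<Longrightarrow> h z = 0" and int: "(\<integral>\<^sup>+z. ennreal (h z) \<partial>lborel) = 1"
    and fixed: "AE z in lborel. transfer h z = h z"
    using Sb_invariant_density[OF assms] by blast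
  \<comment> \<open>The restriction gives \<open>\<mu>\<close> the space and the measurable sets of
    \<open>lambda2 \<beta>\<close>; no mass is lost, because \<open>h\<close> vanishes off the
    triangle.\<close>
  define \<mu> where "\<mu> = restrict_space (density lborel (\<lambda>z. ennreal (h z))) ?S"
  have integral_\<mu>: "(\<integral>\<^sup>+z. f z \<partial>\<mu>) = (\<integral>\<^sup>+z. ennreal (h z) * (f z * indicator ?S z) \<partial>lborel)"
    if "f \<in> borel_measurable \<mu>" for f
  proof -
    have "(\<lambda>z. f z * indicator ?S z) \<in> borel_measurable borel"
      using that unfolding \<mu>_def by (subst (asm) borel_measurable_restrict_space_iff_ennreal) simp_all
    then show ?thesis
      unfolding \<mu>_def by (subst nn_integral_restrict_space) (simp_all add: nn_integral_density)
  qed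
  have sets_\<mu>: "sets \<mu> = sets (restrict_space borel ?S)"
    unfolding \<mu>_def by (rule sets_restrict_space_cong) simp
  have space_\<mu>: "space \<mu> = ?S" by (simp add: \<mu>_def space_restrict_space)
  have "emeasure \<mu> (space \<mu>) = (\<integral>\<^sup>+z. 1 \<partial>\<mu>)" by simp
  also have "\<dots> = (\<integral>\<^sup>+z. ennreal (h z) * (1 * indicator ?S z) \<partial>lborel)" by (rule integral_\<mu>) simp
  also have "\<dots> = (\<integral>\<^sup>+z. ennreal (h z) \<partial>lborel)"
    by (intro nn_integral_cong) (auto simp: supp split: split_indicator)
  finally have prob: "prob_space \<mu>" by (intro prob_spaceI) (simp add: int)
  have "absolutely_continuous (lambda2 \<beta>) \<mu>"
    unfolding absolutely_continuous_def
  proof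
    fix A assume "A \<in> null_sets (lambda2 \<beta>)"
    then have A: "A \<subseteq> ?S" "A \<in> sets borel" "emeasure (uniform_measure lborel ?S) A = 0"
      unfolding lambda2_def by (subst (asm) null_sets_restrict_space; auto simp: null_sets_def)+
    \<comment> \<open>Finite area matters: \<open>uniform_measure\<close> divides by it, and a
      quotient by infinity would vanish without \<open>A\<close> being null.\<close>
    have "?S \<subseteq> {0..1/(\<beta>-1)} \<times> {0..1/(\<beta>-1)}" by (auto simp: Sb_iff mem_Times_iff)
    then have "bounded ?S" by (rule bounded_subset[rotated]) (intro bounded_Times bounded_closed_interval)
    then have "emeasure lborel ?S < \<infinity>" by (rule emeasure_bounded_finite)
    then have "emeasure lborel A = 0"
      using A by (auto simp: emeasure_uniform_measure Int_absorb1 ennreal_divide_eq_0_iff)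
    then have "A \<in> null_sets lborel" using A by auto
    moreover from this have "AE z in lborel. z \<in> A \<longrightarrow> ennreal (h z) = 0"
      using AE_not_in[of A lborel] by (auto elim: eventually_mono)
    ultimately have "A \<in> null_sets (density lborel (\<lambda>z. ennreal (h z)))"
      by (subst null_sets_density_iff) auto
    then show "A \<in> null_sets \<mu>"
      unfolding \<mu>_def using A(1) by (simp add: null_sets_restrict_space)
  qed
  moreover have "sets \<mu> = sets (lambda2 \<beta>)"
    unfolding sets_\<mu> lambda2_def by (rule sets_restrict_space_cong) simp
  moreover have "invariant_measure (m1 p \<Otimes>\<^sub>M (m2 s t \<Otimes>\<^sub>M \<mu>)) (Kb \<beta>)"
    unfolding invariant_measure_def
  proof
    let ?N = "m1 p \<Otimes>\<^sub>M (m2 s t \<Otimes>\<^sub>M \<mu>)"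
    interpret m1: prob_space "m1 p" by (rule prob_space_m1)
    interpret m2: prob_space "m2 s t" by (rule prob_space_m2)
    interpret \<mu>: prob_space \<mu> by (rule prob)
    interpret m2\<mu>: pair_prob_space "m2 s t" \<mu> ..
    interpret N: pair_prob_space "m1 p" "m2 s t \<Otimes>\<^sub>M \<mu>" ..
    show K [measurable]: "Kb \<beta> \<in> ?N \<rightarrow>\<^sub>M ?N"
      by (rule Kb_measurable[OF assms(1,2) sets_\<mu>])
    \<comment> \<open>With \<open>z\<close> outermost, the inner integrals run over the sequences at
      a fixed point, as \<open>Kb_fibre_integral\<close> requires.\<close>
    have iterated: "(\<integral>\<^sup>+x. G x \<partial>?N) = (\<integral>\<^sup>+z. \<integral>\<^sup>+v. \<integral>\<^sup>+x. G (x, v, z) \<partial>m1 p \<partial>m2 s t \<partial>\<mu>)"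
      if [measurable]: "G \<in> borel_measurable ?N" for G
    proof -
      have "(\<integral>\<^sup>+x. G x \<partial>?N) = (\<integral>\<^sup>+y. \<integral>\<^sup>+x. G (x, y) \<partial>m1 p \<partial>(m2 s t \<Otimes>\<^sub>M \<mu>))"
        by (rule N.nn_integral_snd[symmetric]) measurable
      also have "\<dots> = (\<integral>\<^sup>+z. \<integral>\<^sup>+v. \<integral>\<^sup>+x. G (x, v, z) \<partial>m1 p \<partial>m2 s t \<partial>\<mu>)"
        by (rule m2\<mu>.nn_integral_snd[symmetric]) measurable
      finally show ?thesis .
    qed
    show "distr ?N ?N (Kb \<beta>) = ?N"
    proof (rule measure_eqI)
      fix A assume "A \<in> sets (distr ?N ?N (Kb \<beta>))"
      then have A [measurable]: "A \<in> sets ?N" by simp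
      define G where "G = (indicator A :: _ \<Rightarrow> ennreal)"
      have G [measurable]: "G \<in> borel_measurable ?N" unfolding G_def by measurable
      define H where "H z = (\<integral>\<^sup>+v. \<integral>\<^sup>+x. G (x, v, z) \<partial>m1 p \<partial>m2 s t)" for z
      have H [measurable]: "H \<in> borel_measurable \<mu>" unfolding H_def by measurable
      \<comment> \<open>\<open>H\<close> is known to be measurable on the triangle only; extension
        by zero makes it a test function on the plane for \<open>transfer_adjoint\<close>.\<close>
      define H' where "H' z = H z * indicator ?S z" for z
      have H' [measurable]: "H' \<in> borel_measurable borel"
        using H unfolding H'_def \<mu>_def by (subst (asm) borel_measurable_restrict_space_iff_ennreal) simp_all
      have "emeasure (distr ?N ?N (Kb \<beta>)) A = (\<integral>\<^sup>+x. G x \<partial>distr ?N ?N (Kb \<beta>))"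
        unfolding G_def by simp
      also have "\<dots> = (\<integral>\<^sup>+x. G (Kb \<beta> x) \<partial>?N)"
        by (rule nn_integral_distr) measurable
      also have "\<dots> = (\<integral>\<^sup>+z. \<integral>\<^sup>+v. \<integral>\<^sup>+x. G (Kb \<beta> (x, v, z)) \<partial>m1 p \<partial>m2 s t \<partial>\<mu>)"
        by (rule iterated) measurable
      also have "\<dots> = (\<integral>\<^sup>+z. ennreal (h z) * ((\<integral>\<^sup>+v. \<integral>\<^sup>+x. G (Kb \<beta> (x, v, z)) \<partial>m1 p \<partial>m2 s t) * indicator ?S z) \<partial>lborel)"
        by (rule integral_\<mu>) measurable
      also have "\<dots> = (\<integral>\<^sup>+z. ennreal (h z) * (\<Sum>i<3. ennreal (?w i z) * H' (Tmap \<beta> i z)) \<partial>lborel)"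
      proof (rule nn_integral_cong)
        fix z
        show "ennreal (h z) * ((\<integral>\<^sup>+v. \<integral>\<^sup>+x. G (Kb \<beta> (x, v, z)) \<partial>m1 p \<partial>m2 s t) * indicator ?S z)
          = ennreal (h z) * (\<Sum>i<3. ennreal (?w i z) * H' (Tmap \<beta> i z))"
        proof (cases "z \<in> ?S")
          case True
          \<comment> \<open>Either the weight is zero or the image stays in the triangle, so the
            extension by zero is never noticed.\<close>
          have "ennreal (?w i z) * H (Tmap \<beta> i z) = ennreal (?w i z) * H' (Tmap \<beta> i z)" if "i < 3" for i
            using branch_weight_in_Sb[OF assms(1,2) True that, of p s t]
            by (cases "?w i z = 0") (simp_all add: H'_def)
          then show ?thesis
            using True Kb_fibre_integral[OF assms space_\<mu> G True] by (simp add: H_def)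
        qed (simp add: supp)
      qed
      \<comment> \<open>Duality moves the random step from the test function to the density, where
        the fixed point equation absorbs it.\<close>
      also have "\<dots> = (\<integral>\<^sup>+z. ennreal (transfer h z) * H' z \<partial>lborel)"
        by (rule transfer_adjoint[symmetric]) (auto simp: pos)
      also have "\<dots> = (\<integral>\<^sup>+z. ennreal (h z) * H' z \<partial>lborel)"
        by (rule nn_integral_cong_AE) (use fixed in eventually_elim, simp)
      also have "\<dots> = (\<integral>\<^sup>+z. H z \<partial>\<mu>)"
        unfolding H'_def by (rule integral_\<mu>[symmetric, OF H])
      also have "\<dots> = (\<integral>\<^sup>+x. G x \<partial>?N)"
        unfolding H_def by (rule iterated[symmetric]) measurable
      also have "\<dots> = emeasure ?N A" unfolding G_def by simp
      finally show "emeasure (distr ?N ?N (Kb \<beta>)) A = emeasure ?N A" .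
    qed simp
  qed
  ultimately show ?thesis using prob by blast
qed

end
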